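(* Let $1\le k<n$, $T\ge1$, and let $x_1,\dots,x_T\in\mathbb{R}^n$ with $\|x_t\|\le1$. Let $\mathscr{B}^n_{n-k}=\{W\in\mathbb{R}^{n\times n}:W=W^\top\succeq0,\ \|W\|_2\le\frac1{n-k},\ \mathrm{Tr}(W)=1\}$. Run the following uncentered online adaptive PCA algorithm: start from $W_1\in\mathscr{B}^n_{n-k}$; at each $t$, eigendecompose $W_t=\bar D\,\mathrm{diag}(w_t)\bar D^\top$, write $w_t$ as a convex combination $\sum_jp_jr_j$ of vectors $r_j$ having $n-k$ entries equal to $\frac1{n-k}$ and the rest $0$, sample $r=r_j$ with probability $p_j$, and play the rank-$k$ projection $P_t=I-(n-k)\bar D\,\mathrm{diag}(r)\bar D^\top$ (so the expected compression loss is $(n-k)\mathrm{Tr}(W_tx_tx_t^\top)$); then observe $x_t$ and update $$V_{t+1}=\frac{\exp(\ln W_t-\eta x_tx_t^\top)}{\mathrm{Tr}\exp(\ln W_t-\eta x_tx_t^\top)},\ V_{t+1}=U\mathrm{diag}(v_{t+1})U^\top,\ \widehat W_{t+1}=U\mathrm{diag}\Big(\frac\alpha n+(1-\alpha)v_{t+1}\Big)U^\top,$$ $$W_{t+1}=\operatorname{argmin}_{W\in\mathscr{B}^n_{n-k}}\Delta(W,\widehat W_{t+1}),$$ where $\Delta(P,Q)=\mathrm{Tr}(P\ln P)-\mathrm{Tr}(P\ln Q)$. Suppose $L>0$ satisfies $\min_{Q\in\mathscr{B}^n_{n-k}}\sum_{t=r}^s(n-k)\mathrm{Tr}(Qx_tx_t^\top)\le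 L$ for all $1\le r\le s\le T$, and set $\alpha=\frac1{T(n-k)+1}$, $D=(n-k)\ln(n(1+(n-k)T))+1$, $\eta=\ln(1+\sqrt{2D/L})$. Then $$\mathcal{R}_a:=\max_{[r,s]\subset[1,T]}\Big\{\sum_{t=r}^s\mathbb{E}[\mathrm{Tr}((I-P_t)x_tx_t^\top)]-\min_{U\in\mathcal{S}}\sum_{t=r}^s\mathrm{Tr}((I-U)x_tx_t^\top)\Big\}\le O(\sqrt{2LD}+D),$$ where $\mathcal{S}$ is the set of rank-$k$ orthogonal projection matrices in $\mathbb{R}^{n\times n}$.
   Context: $\ln$ and $\exp$ of symmetric matrices are matrix logarithm/exponential. $O(\cdot)$ hides an absolute constant.
   Formalization: The initial matrix W_1 is additionally assumed positive definite, since ln W_1 in the first update is undefined for a singular W_1 (e.g. a rank-(n-k) projection divided by n-k, which lies in the capped set). *)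

theory Defs
  imports Complex_Main "Jordan_Normal_Form.DL_Rank"
begin

definition mtrace :: "real mat \<Rightarrow> real" where
  "mtrace A = (\<Sum>i<dim_row A. A $$ (i,i))"

definition vnorm :: "real vec \<Rightarrow> real" where
  "vnorm v = sqrt (v \<bullet> v)"

definition spec_norm :: "real mat \<Rightarrow> real" where
  "spec_norm A = Sup {vnorm (A *\<^sub>v v) | v. v \<in> carrier_vec (dim_col A) \<and> vnorm v \<le> 1}"

definition sym_psd :: "nat \<Rightarrow> real mat \<Rightarrow> bool" where
  "sym_psd n A \<longleftrightarrow> A \<in> carrier_mat n n \<and> transpose_mat A = A \<and>
     (\<forall>v \<in> carrier_vec n. 0 \<le> v \<bullet> (A *\<^sub>v v))"

definition pos_def :: "nat \<Rightarrow> real mat \<Rightarrow> bool" where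
  "pos_def n A \<longleftrightarrow> A \<in> carrier_mat n n \<and> transpose_mat A = A \<and>
     (\<forall>v \<in> carrier_vec n. v \<noteq> 0\<^sub>v n \<longrightarrow> 0 < v \<bullet> (A *\<^sub>v v))"

definition capped :: "nat \<Rightarrow> nat \<Rightarrow> real mat set" where
  "capped n m = {W. sym_psd n W \<and> spec_norm W \<le> 1 / real m \<and> mtrace W = 1}"

definition orth_mat :: "nat \<Rightarrow> real mat \<Rightarrow> bool" where
  "orth_mat n U \<longleftrightarrow> U \<in> carrier_mat n n \<and> transpose_mat U * U = 1\<^sub>m n"

definition mat_fun :: "nat \<Rightarrow> (real \<Rightarrow> real) \<Rightarrow> real mat \<Rightarrow> real mat" where
  "mat_fun n f A = (SOME B. \<exists>U l. orth_mat n U \<and> A = U * mat_diag n l * transpose_mat U \<and>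
                              B = U * mat_diag n (f \<circ> l) * transpose_mat U)"

definition mexp :: "nat \<Rightarrow> real mat \<Rightarrow> real mat" where
  "mexp n A = mat_fun n exp A"

definition mln :: "nat \<Rightarrow> real mat \<Rightarrow> real mat" where
  "mln n A = mat_fun n ln A"

definition outer :: "real vec \<Rightarrow> real mat" where
  "outer x = mat (dim_vec x) (dim_vec x) (\<lambda>(i,j). x $ i * x $ j)"

definition rel_ent :: "nat \<Rightarrow> real mat \<Rightarrow> real mat \<Rightarrow> real" where
  "rel_ent n P Q = mtrace (P * mln n P) - mtrace (P * mln n Q)"

definition proj_set :: "nat \<Rightarrow> nat \<Rightarrow> real mat set" where
  "proj_set n k = {U. U \<in> carrier_mat n n \<and> transpose_mat U = U \<and> U * U = U \<and>
                       vec_space.rank n U = k}"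

definition cap_vertex :: "nat \<Rightarrow> nat \<Rightarrow> (nat \<Rightarrow> real) \<Rightarrow> bool" where
  "cap_vertex n m r \<longleftrightarrow> (\<forall>i<n. r i = 1 / real m \<or> r i = 0) \<and>
                          card {i. i < n \<and> r i = 1 / real m} = m"

definition valid_decomp :: "nat \<Rightarrow> nat \<Rightarrow> real mat \<Rightarrow> real mat \<Rightarrow> (nat \<Rightarrow> real)
    \<Rightarrow> (real \<times> (nat \<Rightarrow> real)) list \<Rightarrow> bool" where
  "valid_decomp n k W Db w mix \<longleftrightarrow>
     orth_mat n Db \<and> W = Db * mat_diag n w * transpose_mat Db \<and>
     (\<forall>(p, r) \<in> set mix. 0 \<le> p \<and> cap_vertex n (n - k) r) \<and>
     sum_list (map fst mix) = 1 \<and>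
     (\<forall>i<n. w i = (\<Sum>(p, r) \<leftarrow> mix. p * r i))"

definition played_proj :: "nat \<Rightarrow> nat \<Rightarrow> real mat \<Rightarrow> (nat \<Rightarrow> real) \<Rightarrow> real mat" where
  "played_proj n k Db r = 1\<^sub>m n - real (n - k) \<cdot>\<^sub>m (Db * mat_diag n r * transpose_mat Db)"

definition exp_loss :: "nat \<Rightarrow> nat \<Rightarrow> real mat \<Rightarrow> (real \<times> (nat \<Rightarrow> real)) list \<Rightarrow> real vec \<Rightarrow> real" where
  "exp_loss n k Db mix x =
     (\<Sum>(p, r) \<leftarrow> mix. p * mtrace ((1\<^sub>m n - played_proj n k Db r) * outer x))"

definition hat_update :: "nat \<Rightarrow> real \<Rightarrow> real \<Rightarrow> real mat \<Rightarrow> real vec \<Rightarrow> real mat" where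
  "hat_update n \<alpha> \<eta> W x =
     (let M = mexp n (mln n W - \<eta> \<cdot>\<^sub>m outer x);
          V = (1 / mtrace M) \<cdot>\<^sub>m M
      in mat_fun n (\<lambda>v. \<alpha> / real n + (1 - \<alpha>) * v) V)"

definition alpha_par :: "nat \<Rightarrow> nat \<Rightarrow> nat \<Rightarrow> real" where
  "alpha_par n k T = 1 / (real T * real (n - k) + 1)"

definition D_par :: "nat \<Rightarrow> nat \<Rightarrow> nat \<Rightarrow> real" where
  "D_par n k T = real (n - k) * ln (real n * (1 + real (n - k) * real T)) + 1"

definition eta_par :: "nat \<Rightarrow> nat \<Rightarrow> nat \<Rightarrow> real \<Rightarrow> real" where
  "eta_par n k T L = ln (1 + sqrt (2 * D_par n k T / L))"

end

(* The analysis tracks the quantum relative entropy from a comparator Q to the iterate. In a pair of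
   eigenbases it is a classical relative entropy with respect to the squared overlaps, so it dominates
   the squared Hilbert-Schmidt distance of the matrix square roots. This yields the one-step bound
   \<eta> / (1 + \<eta>) * x'Wx <= D(Q, W) - D(Q, V) + \<eta> * x'Qx without the Golden-Thompson inequality, at
   the cost of an absolute constant. Mixing with I/n costs -ln (1 - \<alpha>) per step, and bounds the
   entropy from Q to the iterate at the start of any interval by ln (n/\<alpha>). *)

theory Submission
  imports Defs "Jordan_Normal_Form.Schur_Decomposition" "Jordan_Normal_Form.Spectral_Radius"
begin

section \<open>Orthogonal diagonalization\<close>

text \<open>The classical route through Golden-Thompson has the coefficient 1 - exp (-\<eta>) where
  \<eta> / (1 + \<eta>) stands here. The latter is smaller: it is the largest c with c * b^2 \<le>
  (a - b)^2 + \<eta> * a^2 for all real a and b, where a and b play the role of coordinates of the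
  square roots of the two states applied to x. Dividing by it puts the factor 1 + \<eta> on the
  comparator loss, and the tuned \<eta> turns this into the constant 3.

  The two parts of D come from the choice of \<alpha>. First, n/\<alpha> = n(1 + (n-k)T) is the
  argument of its logarithm. Second, -(n-k) T ln (1 - \<alpha>) \<le> 1, which is its summand 1.

  Two notions in the algorithm are given only implicitly: matrix functions choose a diagonalization,
  and the update is any minimizer of the relative entropy. Both are first identified with explicit
  expressions in an eigenbasis. Projections of rank k enter the regret only through the capped set,
  of which their scaled complements are members.\<close>

definition conj_diag :: "nat \<Rightarrow> real mat \<Rightarrow> (nat \<Rightarrow> real) \<Rightarrow> real mat" where
  "conj_diag n U l = U * mat_diag n l * transpose_mat U"

lemma conj_diag_carrier [simp]: "U \<in> carrier_mat n n \<Longrightarrow> conj_diag n U l \<in> carrier_mat n n"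
  by (auto simp: conj_diag_def)

lemma conj_diag_dim [simp]: "dim_row (conj_diag n U l) = dim_row U" "dim_col (conj_diag n U l) = dim_row U"
  by (auto simp: conj_diag_def)

lemma orth_matD:
  assumes "orth_mat n U"
  shows "U \<in> carrier_mat n n" "transpose_mat U * U = 1\<^sub>m n" "U * transpose_mat U = 1\<^sub>m n"
  using assms mat_mult_left_right_inverse[of "transpose_mat U" n U] by (auto simp: orth_mat_def)

lemma orth_mat_one: "orth_mat n (1\<^sub>m n)"
  by (auto simp: orth_mat_def)

lemma orth_mat_mult:
  assumes "orth_mat n U" "orth_mat n V"
  shows "orth_mat n (U * V)"
proof -
  note U = orth_matD[OF assms(1)] and V = orth_matD[OF assms(2)]
  have "transpose_mat (U * V) * (U * V) = transpose_mat V * (transpose_mat U * U) * V"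
    using U(1) V(1) by (simp add: transpose_mult[of U n n V n] assoc_mult_mat[of _ n n _ n _ n])
  then show ?thesis
    using U V by (simp add: orth_mat_def)
qed

lemma conj_diag_index:
  assumes "U \<in> carrier_mat n n" "i < n" "j < n"
  shows "conj_diag n U l $$ (i, j) = (\<Sum>k<n. U $$ (i, k) * l k * U $$ (j, k))"
  using assms unfolding conj_diag_def
  by (subst mat_diag_mult_right[of _ n n]) (auto simp: scalar_prod_def atLeast0LessThan)

lemma transpose_conj_diag:
  assumes "U \<in> carrier_mat n n"
  shows "transpose_mat (conj_diag n U l) = conj_diag n U l"
  using assms by (intro eq_matI) (auto simp: conj_diag_index mult_ac intro!: sum.cong)

lemma conj_diag_cong:
  assumes "U \<in> carrier_mat n n" "\<And>k. k < n \<Longrightarrow> f k = g k"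
  shows "conj_diag n U f = conj_diag n U g"
  using assms by (intro eq_matI) (auto simp: conj_diag_index)

lemma conj_diag_mult_conj:
  assumes "W \<in> carrier_mat n n" "U \<in> carrier_mat n n"
  shows "W * conj_diag n U l * transpose_mat W = conj_diag n (W * U) l"
  using assms unfolding conj_diag_def
  by (simp add: transpose_mult[of W n n U n] assoc_mult_mat[of _ n n _ n _ n] mult_carrier_mat[of _ n n _ n])

lemma symmetric_bilinear_swap:
  fixes A :: "real mat"
  assumes "A \<in> carrier_mat n n" "transpose_mat A = A" "a \<in> carrier_vec n" "b \<in> carrier_vec n"
  shows "a \<bullet> (A *\<^sub>v b) = b \<bullet> (A *\<^sub>v a)"
  using assms
  by (metis comm_scalar_prod mult_mat_vec_carrier transpose_vec_mult_scalar)

lemma scalar_self_nonneg: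
  fixes v :: "real vec"
  shows "0 \<le> v \<bullet> v"
  by (auto simp: scalar_prod_def intro!: sum_nonneg)

lemma scalar_self_pos:
  fixes v :: "real vec"
  assumes "v \<in> carrier_vec n" "v \<noteq> 0\<^sub>v n"
  shows "0 < v \<bullet> v"
proof -
  obtain i where "i < n" "v $ i \<noteq> 0"
    using assms by (metis carrier_vecD eq_vecI index_zero_vec)
  then show ?thesis
    using assms unfolding scalar_prod_def
    by (intro sum_pos2[of _ i]) (auto simp: zero_less_mult_iff)
qed

text \<open>An eigenvalue z exists over the complex numbers. With eigenvector a + ib, computing the
  bilinear form of a and b in both orders gives Im z * (|a|^2 + |b|^2) = 0 by symmetry. So z is
  real, and a or b, whichever is nonzero, is a real eigenvector.\<close>

lemma symmetric_real_eigenvector: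
  fixes A :: "real mat"
  assumes A: "A \<in> carrier_mat n n" and sym: "transpose_mat A = A" and n: "n > 0"
  shows "\<exists>v e. eigenvector A v e"
proof -
  let ?c = "of_real :: real \<Rightarrow> complex"
  have Ac: "map_mat ?c A \<in> carrier_mat n n" using A by auto
  obtain z where "eigenvalue (map_mat ?c A) z"
    using spectrum_non_empty[OF Ac n] by (auto simp: spectrum_def)
  then obtain v where v: "v \<in> carrier_vec n" "v \<noteq> 0\<^sub>v n" "map_mat ?c A *\<^sub>v v = z \<cdot>\<^sub>v v"
    using Ac by (auto simp: eigenvalue_def eigenvector_def)
  define a where "a = map_vec Re v"
  define b where "b = map_vec Im v"
  have ab: "a \<in> carrier_vec n" "b \<in> carrier_vec n"
    using v(1) by (auto simp: a_def b_def)
  have v_row: "(\<Sum>j<n. ?c (A $$ (i, j)) * v $ j) = z * v $ i" if "i < n" for i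
    using arg_cong[OF v(3), of "\<lambda>w. w $ i"] that A v(1)
    by (simp add: scalar_prod_def atLeast0LessThan)
  have Aa: "A *\<^sub>v a = Re z \<cdot>\<^sub>v a - Im z \<cdot>\<^sub>v b"
  proof (rule eq_vecI)
    fix i assume "i < dim_vec (Re z \<cdot>\<^sub>v a - Im z \<cdot>\<^sub>v b)"
    then have i: "i < n" using ab by auto
    show "(A *\<^sub>v a) $ i = (Re z \<cdot>\<^sub>v a - Im z \<cdot>\<^sub>v b) $ i"
      using arg_cong[OF v_row[OF i], of Re] i A v(1)
      by (simp add: scalar_prod_def atLeast0LessThan a_def b_def)
  qed (use A ab in auto)
  have Ab: "A *\<^sub>v b = Re z \<cdot>\<^sub>v b + Im z \<cdot>\<^sub>v a"
  proof (rule eq_vecI)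
    fix i assume "i < dim_vec (Re z \<cdot>\<^sub>v b + Im z \<cdot>\<^sub>v a)"
    then have i: "i < n" using ab by auto
    show "(A *\<^sub>v b) $ i = (Re z \<cdot>\<^sub>v b + Im z \<cdot>\<^sub>v a) $ i"
      using arg_cong[OF v_row[OF i], of Im] i A v(1)
      by (simp add: scalar_prod_def atLeast0LessThan a_def b_def)
  qed (use A ab in auto)
  have nz: "a \<noteq> 0\<^sub>v n \<or> b \<noteq> 0\<^sub>v n"
  proof (rule ccontr)
    assume "\<not> ?thesis"
    then have "Re (v $ i) = 0" "Im (v $ i) = 0" if "i < n" for i
      using that v(1) index_map_vec(1)[of i v Re] index_map_vec(1)[of i v Im]
      by (simp_all add: a_def b_def)
    then have "v = 0\<^sub>v n" using v(1) by (intro eq_vecI) (auto simp: complex_eq_iff)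
    with v(2) show False by simp
  qed
  have "a \<bullet> (A *\<^sub>v b) = Re z * (a \<bullet> b) + Im z * (a \<bullet> a)"
    unfolding Ab using ab by (simp add: scalar_prod_add_distrib[of _ n])
  moreover have "b \<bullet> (A *\<^sub>v a) = Re z * (a \<bullet> b) - Im z * (b \<bullet> b)"
    unfolding Aa using ab by (simp add: scalar_prod_minus_distrib[of _ n] comm_scalar_prod[of b n a])
  ultimately have "Im z * (a \<bullet> a + b \<bullet> b) = 0"
    using symmetric_bilinear_swap[OF A sym ab] by (simp add: algebra_simps)
  moreover have "a \<bullet> a + b \<bullet> b > 0"
  proof -
    note scalar_self_nonneg[of a] scalar_self_nonneg[of b]
      scalar_self_pos[OF ab(1)] scalar_self_pos[OF ab(2)]
    with nz show ?thesis by linarith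
  qed
  ultimately have "Im z = 0" by simp
  then have "A *\<^sub>v a = Re z \<cdot>\<^sub>v a" "A *\<^sub>v b = Re z \<cdot>\<^sub>v b"
    using Aa Ab ab by auto
  with nz ab A show ?thesis
    by (auto simp: eigenvector_def)
qed

text \<open>Gram-Schmidt applied to a basis that begins with \<open>v\<close> keeps the first
  vector, and normalizing the result changes it only by the scalar \<open>c\<close>. That suffices,
  since an eigenvector matters only up to scale.\<close>

lemma orth_mat_first_column:
  fixes v :: "real vec"
  assumes v: "v \<in> carrier_vec n" and vv: "v \<noteq> 0\<^sub>v n"
  shows "\<exists>W c. orth_mat n W \<and> col W 0 = c \<cdot>\<^sub>v v"
proof -
  interpret cof_vec_space n "TYPE(real)" .
  define b where "b = basis_completion v"
  define ws where "ws = gram_schmidt n b"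
  from basis_completion[OF v vv, folded b_def]
  have dist_b: "distinct b" and indep: "\<not> lin_dep (set b)"
    and b: "set b \<subseteq> carrier_vec n" and hdb: "hd b = v" and len_b: "length b = n" by auto
  have n: "n > 0" using vv v by (cases n) auto
  with hdb len_b obtain vs where bv: "b = v # vs" by (cases b) auto
  from gram_schmidt_result[OF b dist_b indep refl, folded ws_def]
  have ws: "set ws \<subseteq> carrier_vec n" "corthogonal ws" "length ws = n"
    by (auto simp: len_b)
  from gram_schmidt_hd[OF v, of vs, folded bv] have hdws: "hd ws = v" unfolding ws_def .
  \<comment> \<open>Over the reals conjugation is the identity, so \<open>corthogonal\<close> is
    ordinary orthogonality.\<close>
  have conj: "conjugate w = w" for w :: "real vec"
    by (intro eq_vecI) auto
  have orth: "ws ! i \<bullet> ws ! j = 0 \<longleftrightarrow> i \<noteq> j" if "i < n" "j < n" for i j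
    using corthogonalD[OF ws(2), of i j] that ws(3) by (simp add: conj)
  have wsc: "ws ! i \<in> carrier_vec n" if "i < n" for i
    using ws(1,3) that by auto
  define c where "c i = 1 / sqrt (ws ! i \<bullet> ws ! i)" for i
  define us where "us = map (\<lambda>i. c i \<cdot>\<^sub>v (ws ! i)) [0..<n]"
  define W where "W = mat_of_cols n us"
  have len_us: "length us = n" by (simp add: us_def)
  have W: "W \<in> carrier_mat n n" unfolding W_def using len_us by auto
  have colW: "col W i = c i \<cdot>\<^sub>v (ws ! i)" if "i < n" for i
    unfolding W_def using that wsc[OF that] len_us
    by (subst col_mat_of_cols) (auto simp: us_def)
  have "transpose_mat W * W = 1\<^sub>m n"
  proof (rule eq_matI)
    fix i j assume "i < dim_row (1\<^sub>m n :: real mat)" "j < dim_col (1\<^sub>m n :: real mat)"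
    then have ij: "i < n" "j < n" by auto
    have "ws ! i \<bullet> ws ! i > 0"
      using orth[OF ij(1) ij(1)] scalar_self_nonneg[of "ws ! i"] by linarith
    then have "c i * (c i * (ws ! i \<bullet> ws ! i)) = 1"
      by (simp add: c_def)
    then show "(transpose_mat W * W) $$ (i, j) = 1\<^sub>m n $$ (i, j)"
      using ij W wsc[OF ij(1)] wsc[OF ij(2)] orth[OF ij] by (auto simp: colW)
  qed (use W in auto)
  then have "orth_mat n W" using W by (simp add: orth_mat_def)
  moreover have "col W 0 = c 0 \<cdot>\<^sub>v v"
    using colW[OF n] hdws ws(3) n by (cases ws) auto
  ultimately show ?thesis by blast
qed

text \<open>Deflation. Conjugating by an orthogonal matrix whose first column is an eigenvector
  clears the first column outside the corner, and by symmetry also the first row. The remaining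
  block is symmetric of size \<open>n\<close>, so the induction hypothesis diagonalizes it.\<close>

theorem symmetric_spectral:
  assumes "A \<in> carrier_mat n n" "transpose_mat A = A"
  shows "\<exists>U l. orth_mat n U \<and> A = conj_diag n U l"
  using assms
proof (induction n arbitrary: A)
  case 0
  then show ?case
    by (intro exI[of _ "1\<^sub>m 0"] exI[of _ "\<lambda>_. 0"]) (auto simp: orth_mat_def)
next
  case (Suc n)
  note A = Suc.prems(1) and sym = Suc.prems(2)
  obtain v e where ev: "eigenvector A v e"
    using symmetric_real_eigenvector[OF A sym] by auto
  then have v: "v \<in> carrier_vec (Suc n)" "v \<noteq> 0\<^sub>v (Suc n)" "A *\<^sub>v v = e \<cdot>\<^sub>v v"
    using A by (auto simp: eigenvector_def)
  obtain W c where oW: "orth_mat (Suc n) W" and c: "col W 0 = c \<cdot>\<^sub>v v"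
    using orth_mat_first_column[OF v(1,2)] by auto
  note W = orth_matD[OF oW]
  define B where "B = transpose_mat W * A * W"
  have B: "B \<in> carrier_mat (Suc n) (Suc n)"
    using A W by (auto simp: B_def)
  have Bsym: "transpose_mat B = B"
    using A W sym by (simp add: B_def transpose_mult[of _ "Suc n" "Suc n" _ "Suc n"]
        assoc_mult_mat[of _ "Suc n" "Suc n" _ "Suc n" _ "Suc n"] mult_carrier_mat[of _ "Suc n" "Suc n" _ "Suc n"])
  have Bij: "B $$ (i, j) = col W i \<bullet> (A *\<^sub>v col W j)" if "i < Suc n" "j < Suc n" for i j
  proof -
    have "B = transpose_mat W * (A * W)"
      using A W(1) unfolding B_def by (intro assoc_mult_mat) auto
    moreover have "col (A * W) j = A *\<^sub>v col W j"
      by (rule col_mult2[OF A W(1) that(2)])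
    ultimately show ?thesis using that A W(1) by simp
  qed
  have ortho: "col W i \<bullet> col W j = (if i = j then 1 else 0)" if "i < Suc n" "j < Suc n" for i j
    using arg_cong[OF W(2), of "\<lambda>M. M $$ (i, j)"] that W(1) by auto
  have A0: "A *\<^sub>v col W 0 = e \<cdot>\<^sub>v col W 0"
    unfolding c using A v by (simp add: mult_mat_vec[of A "Suc n" "Suc n" v] smult_smult_assoc mult.commute)
  have Bcol0: "B $$ (i, 0) = (if i = 0 then e else 0)" if "i < Suc n" for i
    using that W(1) ortho[OF that, of 0] by (simp add: Bij A0)
  have Brow0: "B $$ (0, i) = (if i = 0 then e else 0)" if "i < Suc n" for i
    using Bcol0[OF that] arg_cong[OF Bsym, of "\<lambda>M. M $$ (0, i)"] that B by auto
  define B' where "B' = mat n n (\<lambda>(i, j). B $$ (Suc i, Suc j))"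
  have B': "B' \<in> carrier_mat n n" by (auto simp: B'_def)
  have "B $$ (Suc i, Suc j) = B $$ (Suc j, Suc i)" if "i < n" "j < n" for i j
    using arg_cong[OF Bsym, of "\<lambda>M. M $$ (Suc i, Suc j)"] that B by simp
  then have B'sym: "transpose_mat B' = B'"
    by (intro eq_matI) (auto simp: B'_def)
  obtain U l where oU: "orth_mat n U" and Ul: "B' = conj_diag n U l"
    using Suc.IH[OF B' B'sym] by auto
  note U = orth_matD[OF oU]
  \<comment> \<open>The block matrix diag(1, \<open>U\<close>): it keeps the eigenvector already
    found and diagonalizes the remaining block. Accordingly \<open>case_nat e l\<close> prepends its
    eigenvalue.\<close>
  define F where "F = mat (Suc n) (Suc n) (\<lambda>(i, j). case i of 0 \<Rightarrow> (if j = 0 then 1 else 0)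
      | Suc i' \<Rightarrow> (case j of 0 \<Rightarrow> 0 | Suc j' \<Rightarrow> U $$ (i', j')))"
  have F: "F \<in> carrier_mat (Suc n) (Suc n)" by (auto simp: F_def)
  have oF: "orth_mat (Suc n) F"
  proof -
    have "(transpose_mat F * F) $$ (i, j) = 1\<^sub>m (Suc n) $$ (i, j)" if "i < Suc n" "j < Suc n" for i j
    proof -
      have "(transpose_mat F * F) $$ (i, j) = (\<Sum>k<Suc n. F $$ (k, i) * F $$ (k, j))"
        using that F by (simp add: scalar_prod_def atLeast0LessThan)
      also have "\<dots> = 1\<^sub>m (Suc n) $$ (i, j)"
        using that U(1) arg_cong[OF U(2), of "\<lambda>M. M $$ (i - 1, j - 1)"] unfolding sum.lessThan_Suc_shift
        by (cases i; cases j) (auto simp: F_def scalar_prod_def atLeast0LessThan)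
      finally show ?thesis .
    qed
    then show ?thesis
      using F unfolding orth_mat_def by (intro conjI eq_matI) auto
  qed
  have BF: "B = conj_diag (Suc n) F (case_nat e l)"
  proof (rule eq_matI)
    fix i j assume "i < dim_row (conj_diag (Suc n) F (case_nat e l))"
      "j < dim_col (conj_diag (Suc n) F (case_nat e l))"
    then have ij: "i < Suc n" "j < Suc n" using F by auto
    have *: "B $$ (Suc i', Suc j') = (\<Sum>k<n. U $$ (i', k) * l k * U $$ (j', k))" if "i' < n" "j' < n" for i' j'
      using arg_cong[OF Ul, of "\<lambda>M. M $$ (i', j')"] that U(1) by (simp add: B'_def conj_diag_index)
    show "B $$ (i, j) = conj_diag (Suc n) F (case_nat e l) $$ (i, j)"
      unfolding conj_diag_index[OF F ij] sum.lessThan_Suc_shift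
      using ij Bcol0 Brow0 by (cases i; cases j) (auto simp: F_def *)
  qed (use B F in auto)
  have "A = W * B * transpose_mat W"
  proof -
    have "W * B * transpose_mat W = (W * transpose_mat W) * A * (W * transpose_mat W)"
      using A W(1) by (simp add: B_def assoc_mult_mat[of _ "Suc n" "Suc n" _ "Suc n" _ "Suc n"]
          mult_carrier_mat[of _ "Suc n" "Suc n" _ "Suc n"])
    then show ?thesis using A W by simp
  qed
  then have "A = conj_diag (Suc n) (W * F) (case_nat e l)"
    using BF conj_diag_mult_conj[OF W(1) F] by simp
  then show ?case
    using orth_mat_mult[OF oW oF] by blast
qed

section \<open>Quantum relative entropy in eigenbases\<close>

text \<open>Cauchy-Schwarz, read off from Lagrange's identity: twice the defect is the double sum of
  the squares (f i * g j - f j * g i)^2.\<close>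

lemma sum_mult_power2_le:
  fixes f g :: "'a \<Rightarrow> real"
  shows "(\<Sum>i\<in>A. f i * g i)\<^sup>2 \<le> (\<Sum>i\<in>A. (f i)\<^sup>2) * (\<Sum>i\<in>A. (g i)\<^sup>2)"
proof -
  have "0 \<le> (\<Sum>i\<in>A. \<Sum>j\<in>A. (f i * g j - f j * g i)\<^sup>2)"
    by (intro sum_nonneg) simp
  also have "\<dots> = (\<Sum>i\<in>A. \<Sum>j\<in>A. (f i)\<^sup>2 * (g j)\<^sup>2) + (\<Sum>i\<in>A. \<Sum>j\<in>A. (g i)\<^sup>2 * (f j)\<^sup>2)
      - 2 * (\<Sum>i\<in>A. \<Sum>j\<in>A. (f i * g i) * (f j * g j))"
    by (simp add: power2_diff power_mult_distrib sum.distrib sum_subtractf sum_distrib_left mult_ac)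
  also have "\<dots> = 2 * ((\<Sum>i\<in>A. (f i)\<^sup>2) * (\<Sum>i\<in>A. (g i)\<^sup>2)) - 2 * (\<Sum>i\<in>A. f i * g i)\<^sup>2"
    by (simp only: sum_product[symmetric] power2_eq_square mult.commute[of "\<Sum>i\<in>A. g i * g i"])
  finally show ?thesis by simp
qed

text \<open>\<open>mat_fun\<close> picks some diagonalization, so independence of the choice has to
  be shown. For two diagonalizations of one matrix, M = U'V satisfies l i * M(i,j) = M(i,j) * l' j.
  Hence an entry of M vanishes unless the two eigenvalues agree, and the relation survives the
  application of \<open>f\<close> to both sides.\<close>

lemma mat_fun_conj_diag:
  assumes U: "orth_mat n U"
  shows "mat_fun n f (conj_diag n U l) = conj_diag n U (f \<circ> l)"
proof -
  have uniq: "conj_diag n V (f \<circ> l') = conj_diag n U (f \<circ> l)"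
    if V: "orth_mat n V" and eq: "conj_diag n U l = conj_diag n V l'" for V l'
  proof -
    note U' = orth_matD[OF U] and V' = orth_matD[OF V]
    define M where "M = transpose_mat U * V"
    have M: "M \<in> carrier_mat n n" using U' V' by (simp add: M_def)
    note assoc = assoc_mult_mat[of _ n n _ n _ n] mult_carrier_mat[of _ n n _ n]
    have inter: "transpose_mat U * conj_diag n U g * V = mat_diag n g * M" for g
    proof -
      have "transpose_mat U * conj_diag n U g * V = (transpose_mat U * U) * mat_diag n g * M"
        using U'(1) V'(1) by (simp add: conj_diag_def M_def assoc)
      then show ?thesis using U' by (simp add: left_mult_one_mat[of _ n n])
    qed
    have inter': "transpose_mat U * conj_diag n V g * V = M * mat_diag n g" for g
    proof -
      have "transpose_mat U * conj_diag n V g * V = M * mat_diag n g * (transpose_mat V * V)"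
        using U'(1) V'(1) by (simp add: conj_diag_def M_def assoc)
      then show ?thesis using V' M by (simp add: right_mult_one_mat[of _ n n] mult_carrier_mat[of _ n n _ n])
    qed
    have comm: "mat_diag n l * M = M * mat_diag n l'"
      using inter[of l] inter'[of l'] eq by simp
    have eig: "l i * M $$ (i, j) = M $$ (i, j) * l' j" if "i < n" "j < n" for i j
      using arg_cong[OF comm, of "\<lambda>X. X $$ (i, j)"] that
      by (simp add: mat_diag_mult_left[OF M] mat_diag_mult_right[OF M])
    have "f (l i) * M $$ (i, j) = M $$ (i, j) * f (l' j)" if "i < n" "j < n" for i j
      using eig[OF that] by (cases "M $$ (i, j) = 0") (auto simp: mult.commute)
    then have "mat_diag n (f \<circ> l) * M = M * mat_diag n (f \<circ> l')"
      using M by (intro eq_matI)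
        (auto simp: mat_diag_mult_left[OF M] mat_diag_mult_right[OF M])
    then have "transpose_mat U * conj_diag n U (f \<circ> l) * V = transpose_mat U * conj_diag n V (f \<circ> l') * V"
      using inter inter' by simp
    then have "U * (transpose_mat U * conj_diag n U (f \<circ> l) * V) * transpose_mat V
      = U * (transpose_mat U * conj_diag n V (f \<circ> l') * V) * transpose_mat V" by simp
    moreover have "U * (transpose_mat U * X * V) * transpose_mat V = X" if "X \<in> carrier_mat n n" for X
    proof -
      have "U * (transpose_mat U * X * V) * transpose_mat V = (U * transpose_mat U) * X * (V * transpose_mat V)"
        using that U'(1) V'(1) by (simp add: assoc)
      then show ?thesis using U' V' that by simp
    qed
    ultimately show ?thesis using U'(1) V'(1) by simp
  qed
  have "\<exists>V l'. orth_mat n V \<and> conj_diag n U l = V * mat_diag n l' * transpose_mat V \<and>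
      mat_fun n f (conj_diag n U l) = V * mat_diag n (f \<circ> l') * transpose_mat V"
    unfolding mat_fun_def by (rule someI_ex) (use U in \<open>auto simp: conj_diag_def\<close>)
  then show ?thesis
    using uniq by (auto simp: conj_diag_def)
qed

section \<open>Quadratic forms and traces in orthonormal bases\<close>

definition quad_form :: "real mat \<Rightarrow> real vec \<Rightarrow> real" where
  "quad_form A v = v \<bullet> (A *\<^sub>v v)"

lemma quad_form_sum:
  assumes "A \<in> carrier_mat n n" "v \<in> carrier_vec n"
  shows "quad_form A v = (\<Sum>i<n. \<Sum>j<n. v $ i * A $$ (i, j) * v $ j)"
  using assms by (simp add: quad_form_def scalar_prod_def atLeast0LessThan sum_distrib_left mult_ac)

lemma mtrace_mult:
  assumes "A \<in> carrier_mat n n" "B \<in> carrier_mat n n"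
  shows "mtrace (A * B) = (\<Sum>i<n. \<Sum>j<n. A $$ (i, j) * B $$ (j, i))"
  using assms by (simp add: mtrace_def scalar_prod_def atLeast0LessThan)

lemma mtrace_outer:
  assumes "A \<in> carrier_mat n n" "x \<in> carrier_vec n"
  shows "mtrace (A * outer x) = quad_form A x"
proof -
  have "outer x \<in> carrier_mat n n" using assms by (simp add: outer_def)
  then show ?thesis
    using assms by (simp add: mtrace_mult quad_form_sum outer_def mult_ac)
qed

lemma mtrace_conj_diag_mult:
  assumes "A \<in> carrier_mat n n" "U \<in> carrier_mat n n"
  shows "mtrace (A * conj_diag n U f) = (\<Sum>k<n. f k * quad_form A (col U k))"
proof -
  have "mtrace (A * conj_diag n U f)
      = (\<Sum>i<n. \<Sum>j<n. \<Sum>k<n. f k * (U $$ (i, k) * A $$ (i, j) * U $$ (j, k)))"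
    using assms by (simp add: mtrace_mult conj_diag_index sum_distrib_left mult_ac)
  also have "\<dots> = (\<Sum>i<n. \<Sum>k<n. \<Sum>j<n. f k * (U $$ (i, k) * A $$ (i, j) * U $$ (j, k)))"
    by (intro sum.cong refl sum.swap)
  also have "\<dots> = (\<Sum>k<n. \<Sum>i<n. \<Sum>j<n. f k * (U $$ (i, k) * A $$ (i, j) * U $$ (j, k)))"
    by (rule sum.swap)
  also have "\<dots> = (\<Sum>k<n. f k * quad_form A (col U k))"
    using assms by (simp add: quad_form_sum[of A n] sum_distrib_left)
  finally show ?thesis .
qed

lemma quad_form_conj_diag:
  assumes "U \<in> carrier_mat n n" "x \<in> carrier_vec n"
  shows "quad_form (conj_diag n U l) x = (\<Sum>k<n. l k * (col U k \<bullet> x)\<^sup>2)"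
proof -
  have *: "col U k \<bullet> x = (\<Sum>i<n. U $$ (i, k) * x $ i)" if "k < n" for k
    using that assms by (simp add: scalar_prod_def atLeast0LessThan)
  have "quad_form (conj_diag n U l) x
      = (\<Sum>i<n. \<Sum>j<n. \<Sum>k<n. l k * ((U $$ (i, k) * x $ i) * (U $$ (j, k) * x $ j)))"
    using assms by (simp add: quad_form_sum[of _ n] conj_diag_index sum_distrib_left sum_distrib_right mult_ac)
  also have "\<dots> = (\<Sum>i<n. \<Sum>k<n. \<Sum>j<n. l k * ((U $$ (i, k) * x $ i) * (U $$ (j, k) * x $ j)))"
    by (intro sum.cong refl sum.swap)
  also have "\<dots> = (\<Sum>k<n. \<Sum>i<n. \<Sum>j<n. l k * ((U $$ (i, k) * x $ i) * (U $$ (j, k) * x $ j)))"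
    by (rule sum.swap)
  also have "\<dots> = (\<Sum>k<n. l k * (col U k \<bullet> x)\<^sup>2)"
    by (intro sum.cong refl) (simp add: * power2_eq_square sum_product sum_distrib_left[symmetric])
  finally show ?thesis .
qed

lemma conj_diag_one:
  assumes "orth_mat n U"
  shows "conj_diag n U (\<lambda>_. 1) = 1\<^sub>m n"
  using orth_matD[OF assms] by (simp add: conj_diag_def)

lemma parseval:
  assumes "orth_mat n U" "x \<in> carrier_vec n"
  shows "(\<Sum>k<n. (col U k \<bullet> x)\<^sup>2) = x \<bullet> x"
  using quad_form_conj_diag[of U n x "\<lambda>_. 1"] orth_matD(1)[OF assms(1)] assms
  by (simp add: conj_diag_one quad_form_def)

lemma orth_mat_col_inner:
  assumes "orth_mat n U" "i < n" "j < n"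
  shows "col U i \<bullet> col U j = (if i = j then 1 else 0)"
  using arg_cong[OF orth_matD(2)[OF assms(1)], of "\<lambda>M. M $$ (i, j)"] orth_matD(1)[OF assms(1)] assms(2,3)
  by auto

lemma quad_form_eigenvector:
  assumes "orth_mat n U" "i < n"
  shows "quad_form (conj_diag n U l) (col U i) = l i"
proof -
  have "quad_form (conj_diag n U l) (col U i) = (\<Sum>k<n. l k * (col U k \<bullet> col U i)\<^sup>2)"
    using orth_matD(1)[OF assms(1)] assms(2) by (intro quad_form_conj_diag) auto
  also have "\<dots> = (\<Sum>k<n. if k = i then l k else 0)"
    using assms(2) by (intro sum.cong) (simp_all add: orth_mat_col_inner[OF assms(1)])
  finally have "quad_form (conj_diag n U l) (col U i) = (\<Sum>k<n. if k = i then l k else 0)" .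
  then show ?thesis using assms(2) by simp
qed

lemma mtrace_conj_diag:
  assumes "orth_mat n U"
  shows "mtrace (conj_diag n U l) = (\<Sum>k<n. l k)"
proof -
  have "mtrace (conj_diag n U l) = mtrace (conj_diag n U (\<lambda>_. 1) * conj_diag n U l)"
    using orth_matD(1)[OF assms] by (simp add: conj_diag_one[OF assms] left_mult_one_mat[of _ n n])
  also have "\<dots> = (\<Sum>k<n. l k)"
    using orth_matD(1)[OF assms] assms by (subst mtrace_conj_diag_mult) (auto simp: quad_form_eigenvector)
  finally show ?thesis .
qed

lemma mtrace_conj_diag_mult_conj_diag:
  assumes "orth_mat n U" "orth_mat n V"
  shows "mtrace (conj_diag n U p * conj_diag n V f)
      = (\<Sum>i<n. \<Sum>j<n. (col U i \<bullet> col V j)\<^sup>2 * (p i * f j))"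
proof -
  have "mtrace (conj_diag n U p * conj_diag n V f)
      = (\<Sum>j<n. \<Sum>i<n. (col U i \<bullet> col V j)\<^sup>2 * (p i * f j))"
    using orth_matD(1)[OF assms(1)] orth_matD(1)[OF assms(2)]
    by (subst mtrace_conj_diag_mult)
      (auto simp: quad_form_conj_diag sum_distrib_left mult_ac intro!: sum.cong)
  also have "\<dots> = (\<Sum>i<n. \<Sum>j<n. (col U i \<bullet> col V j)\<^sup>2 * (p i * f j))"
    by (rule sum.swap)
  finally show ?thesis .
qed

text \<open>Parseval in each of the two bases. These row and column sums are what makes
  \<open>p\<close> and \<open>q\<close> the marginals of the weighted double sums below.\<close>

lemma overlap_sums:
  assumes "orth_mat n U" "orth_mat n V" "k < n"
  shows "(\<Sum>i<n. (col U i \<bullet> col V k)\<^sup>2) = 1" "(\<Sum>j<n. (col U k \<bullet> col V j)\<^sup>2) = 1"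
proof -
  note U = orth_matD(1)[OF assms(1)] and V = orth_matD(1)[OF assms(2)]
  show "(\<Sum>i<n. (col U i \<bullet> col V k)\<^sup>2) = 1"
    using parseval[OF assms(1), of "col V k"] V assms by (simp add: orth_mat_col_inner)
  have "(\<Sum>j<n. (col U k \<bullet> col V j)\<^sup>2) = (\<Sum>j<n. (col V j \<bullet> col U k)\<^sup>2)"
    using U V assms(3) by (intro sum.cong refl arg_cong[of _ _ "\<lambda>t. t\<^sup>2"] comm_scalar_prod[of _ n]) auto
  then show "(\<Sum>j<n. (col U k \<bullet> col V j)\<^sup>2) = 1"
    using parseval[OF assms(2), of "col U k"] U assms by (simp add: orth_mat_col_inner)
qed

text \<open>The relative entropy is that of the two measures p i * a i j and q j * a i j on pairs of
  eigenvectors, where a is the doubly stochastic matrix of squared overlaps.\<close>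

lemma rel_ent_conj_diag:
  assumes "orth_mat n U" "orth_mat n V"
  shows "rel_ent n (conj_diag n U p) (conj_diag n V q)
      = (\<Sum>i<n. \<Sum>j<n. (col U i \<bullet> col V j)\<^sup>2 * (p i * ln (p i) - p i * ln (q j)))"
proof -
  have "mtrace (conj_diag n U p * mln n (conj_diag n U p)) = (\<Sum>i<n. p i * ln (p i))"
    using assms(1) orth_matD(1)[OF assms(1)] unfolding mln_def
    by (simp add: mat_fun_conj_diag mtrace_conj_diag_mult quad_form_eigenvector mult.commute)
  also have "\<dots> = (\<Sum>i<n. \<Sum>j<n. (col U i \<bullet> col V j)\<^sup>2 * (p i * ln (p i)))"
    by (intro sum.cong refl) (simp add: overlap_sums[OF assms] flip: sum_distrib_right)
  finally show ?thesis
    using assms unfolding rel_ent_def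
    by (simp add: mln_def mat_fun_conj_diag mtrace_conj_diag_mult_conj_diag right_diff_distrib sum_subtractf)
qed

text \<open>This is ln t \<le> t - 1 at t = sqrt (q / p), multiplied by 2p. The correction - p + q
  makes the right side nonnegative for every pair, and it disappears on summing two distributions of
  equal mass.\<close>

lemma hellinger_pointwise:
  fixes p q :: real
  assumes "p \<ge> 0" "q > 0"
  shows "(sqrt p - sqrt q)\<^sup>2 \<le> p * ln p - p * ln q - p + q"
proof (cases "p = 0")
  case False
  with assms have p: "p > 0" by simp
  have "ln (sqrt (q / p)) \<le> sqrt (q / p) - 1"
    using p assms by (intro ln_le_minus_one) simp
  then have "ln q - ln p \<le> 2 * sqrt q / sqrt p - 2"
    using p assms by (simp add: ln_sqrt ln_div real_sqrt_divide)
  then have "p * (ln q - ln p) \<le> p * (2 * sqrt q / sqrt p - 2)"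
    using p by (intro mult_left_mono) auto
  also have "\<dots> = 2 * sqrt q * sqrt p - 2 * p"
    using p real_sqrt_mult_self[of p] by (auto simp: field_simps)
  finally show ?thesis
    using assms by (simp add: power2_diff algebra_simps)
qed (use assms in simp)

text \<open>The pointwise bound is averaged over the squared overlaps. Double stochasticity turns
  the sums of the corrections - p i and + q j into the two traces, which cancel by
  assumption.\<close>

lemma rel_ent_ge_hellinger:
  assumes "orth_mat n U" "orth_mat n V" "\<And>i. i < n \<Longrightarrow> p i \<ge> 0" "\<And>j. j < n \<Longrightarrow> q j > 0"
    and "(\<Sum>i<n. p i) = (\<Sum>j<n. q j)"
  shows "(\<Sum>i<n. \<Sum>j<n. (col U i \<bullet> col V j)\<^sup>2 * (sqrt (p i) - sqrt (q j))\<^sup>2)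
      \<le> rel_ent n (conj_diag n U p) (conj_diag n V q)"
proof -
  let ?a = "\<lambda>i j. (col U i \<bullet> col V j)\<^sup>2"
  have p: "(\<Sum>i<n. \<Sum>j<n. ?a i j * p i) = (\<Sum>i<n. p i)"
    by (intro sum.cong refl) (simp add: overlap_sums[OF assms(1,2)] flip: sum_distrib_right)
  have "(\<Sum>i<n. \<Sum>j<n. ?a i j * q j) = (\<Sum>j<n. \<Sum>i<n. ?a i j * q j)"
    by (rule sum.swap)
  also have "\<dots> = (\<Sum>j<n. q j)"
    by (intro sum.cong refl) (simp add: overlap_sums[OF assms(1,2)] flip: sum_distrib_right)
  finally have q: "(\<Sum>i<n. \<Sum>j<n. ?a i j * q j) = (\<Sum>j<n. q j)" .
  have "(\<Sum>i<n. \<Sum>j<n. ?a i j * (sqrt (p i) - sqrt (q j))\<^sup>2)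
      \<le> (\<Sum>i<n. \<Sum>j<n. ?a i j * (p i * ln (p i) - p i * ln (q j) - p i + q j))"
    using assms by (intro sum_mono mult_left_mono hellinger_pointwise) auto
  also have "\<dots> = rel_ent n (conj_diag n U p) (conj_diag n V q)"
    using p q assms(5) unfolding rel_ent_conj_diag[OF assms(1,2)]
    by (simp add: algebra_simps sum.distrib sum_subtractf)
  finally show ?thesis .
qed

lemma rel_ent_nonneg:
  assumes "orth_mat n U" "orth_mat n V" "\<And>i. i < n \<Longrightarrow> p i \<ge> 0" "\<And>j. j < n \<Longrightarrow> q j > 0"
    and "(\<Sum>i<n. p i) = (\<Sum>j<n. q j)"
  shows "0 \<le> rel_ent n (conj_diag n U p) (conj_diag n V q)"
  by (rule order.trans[OF _ rel_ent_ge_hellinger[OF assms]]) (auto intro!: sum_nonneg)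


text \<open>Vanishing entropy makes every Hellinger term vanish, so p i = q j wherever the overlap
  is nonzero. The overlap matrix therefore intertwines the two diagonal matrices, which is equality
  of the operators even when eigenvalues repeat and the bases differ.\<close>

lemma rel_ent_eq_imp_eq:
  assumes "orth_mat n U" "orth_mat n V" "\<And>i. i < n \<Longrightarrow> p i \<ge> 0" "\<And>j. j < n \<Longrightarrow> q j > 0"
    and "(\<Sum>i<n. p i) = (\<Sum>j<n. q j)"
    and le: "rel_ent n (conj_diag n U p) (conj_diag n V q) \<le> 0"
  shows "conj_diag n U p = conj_diag n V q"
proof -
  note U = orth_matD[OF assms(1)] and V = orth_matD[OF assms(2)]
  let ?h = "\<lambda>i j. (col U i \<bullet> col V j)\<^sup>2 * (sqrt (p i) - sqrt (q j))\<^sup>2"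
  have "(\<Sum>i<n. \<Sum>j<n. ?h i j) = 0"
    using rel_ent_ge_hellinger[OF assms(1-5)] le by (intro antisym) (auto intro!: sum_nonneg)
  then have zero: "?h i j = 0" if "i < n" "j < n" for i j
    using that by (simp add: sum_nonneg_eq_0_iff sum_nonneg)
  define M where "M = transpose_mat U * V"
  have M: "M \<in> carrier_mat n n" using U V by (simp add: M_def)
  have Mij: "M $$ (i, j) = col U i \<bullet> col V j" if "i < n" "j < n" for i j
    using that U(1) V(1) by (simp add: M_def)
  have "mat_diag n p * M = M * mat_diag n q"
    using M zero by (intro eq_matI)
      (auto simp: mat_diag_mult_left[OF M] mat_diag_mult_right[OF M] Mij)
  then have "U * (mat_diag n p * M) * transpose_mat V = U * (M * mat_diag n q) * transpose_mat V"
    by simp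
  moreover have "U * (mat_diag n p * M) * transpose_mat V = U * mat_diag n p * transpose_mat U * (V * transpose_mat V)"
    using U(1) V(1) by (simp add: M_def assoc_mult_mat[of _ n n _ n _ n] mult_carrier_mat[of _ n n _ n])
  moreover have "U * (M * mat_diag n q) * transpose_mat V = (U * transpose_mat U) * (V * mat_diag n q * transpose_mat V)"
    using U(1) V(1) by (simp add: M_def assoc_mult_mat[of _ n n _ n _ n] mult_carrier_mat[of _ n n _ n])
  ultimately show ?thesis
    using U V by (simp add: conj_diag_def right_mult_one_mat[of _ n n] left_mult_one_mat[of _ n n] mult_carrier_mat[of _ n n _ n])
qed

text \<open>Measuring both states along x: the square roots of the two outcome probabilities differ by at
  most the Hilbert-Schmidt distance of the matrix square roots, whose square is the sum bounded
  by the relative entropy. This replaces the Golden-Thompson inequality.\<close>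

lemma rel_ent_measurement:
  assumes "orth_mat n U" "orth_mat n V" "\<And>i. i < n \<Longrightarrow> p i \<ge> 0" "\<And>j. j < n \<Longrightarrow> q j > 0"
    and "(\<Sum>i<n. p i) = (\<Sum>j<n. q j)"
    and x: "x \<in> carrier_vec n" "x \<bullet> x \<le> 1" and \<eta>: "\<eta> > 0"
  shows "\<eta> / (1 + \<eta>) * quad_form (conj_diag n V q) x
      \<le> rel_ent n (conj_diag n U p) (conj_diag n V q) + \<eta> * quad_form (conj_diag n U p) x"
proof -
  note U = orth_matD[OF assms(1)] and V = orth_matD[OF assms(2)]
  let ?B = "\<lambda>i j. col U i \<bullet> col V j"
  define y where "y i = col U i \<bullet> x" for i
  define z where "z j = col V j \<bullet> x" for j
  \<comment> \<open>The vector with coordinates \<open>c\<close> in the basis \<open>V\<close>; the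
    overlaps convert these into coordinates in \<open>U\<close>.\<close>
  define syn where "syn c = V *\<^sub>v vec n c" for c
  have syn: "syn c \<in> carrier_vec n" for c using V(1) by (simp add: syn_def)
  have syn_V: "col V j \<bullet> syn c = c j" if "j < n" for c j
  proof -
    have "transpose_mat V *\<^sub>v syn c = vec n c"
      using V by (simp add: syn_def flip: assoc_mult_mat_vec[of _ n n _ n])
    from arg_cong[OF this, of "\<lambda>w. w $ j"] show ?thesis using that V(1) by simp
  qed
  have syn_U: "col U i \<bullet> syn c = (\<Sum>j<n. ?B i j * c j)" if "i < n" for c i
  proof -
    have "col U i \<bullet> syn c = (transpose_mat V *\<^sub>v col U i) \<bullet> vec n c"
      using V(1) U(1) that unfolding syn_def by (subst transpose_vec_mult_scalar[of _ n n]) auto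
    also have "\<dots> = (\<Sum>j<n. ?B i j * c j)"
      using V(1) U(1) that by (auto simp: scalar_prod_def[of _ "vec n c"] atLeast0LessThan
        comm_scalar_prod[of "col V _" n] intro!: sum.cong)
    finally show ?thesis .
  qed
  have "x = syn z"
  proof -
    have "vec n z = transpose_mat V *\<^sub>v x"
      using V(1) by (intro eq_vecI) (auto simp: z_def)
    then show ?thesis using V x by (simp add: syn_def flip: assoc_mult_mat_vec[of _ n n _ n])
  qed
  then have y: "y i = (\<Sum>j<n. ?B i j * z j)" if "i < n" for i
    using syn_U[OF that] by (metis y_def)
  \<comment> \<open>\<open>a\<close> and \<open>b\<close> are the coordinates, both in the basis
    \<open>U\<close>, of sqrt P x and sqrt R x, where P and R are the states with spectra
    \<open>p\<close> and \<open>q\<close>. Their squared norms are the two quadratic forms.\<close>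
  define a where "a i = sqrt (p i) * y i" for i
  define b where "b i = (\<Sum>j<n. ?B i j * (sqrt (q j) * z j))" for i
  have qa: "quad_form (conj_diag n U p) x = (\<Sum>i<n. (a i)\<^sup>2)"
    using U(1) x assms(3) by (auto simp: quad_form_conj_diag a_def y_def power_mult_distrib intro!: sum.cong)
  have qb: "quad_form (conj_diag n V q) x = (\<Sum>i<n. (b i)\<^sup>2)"
  proof -
    let ?s = "syn (\<lambda>j. sqrt (q j) * z j)"
    have "quad_form (conj_diag n V q) x = (\<Sum>j<n. (col V j \<bullet> ?s)\<^sup>2)"
      using V(1) x assms(4)
      by (auto simp: quad_form_conj_diag syn_V z_def power_mult_distrib less_imp_le intro!: sum.cong)
    also have "\<dots> = (\<Sum>i<n. (col U i \<bullet> ?s)\<^sup>2)"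
      using parseval[OF assms(1) syn] parseval[OF assms(2) syn] by simp
    also have "\<dots> = (\<Sum>i<n. (b i)\<^sup>2)"
      by (intro sum.cong refl) (simp add: syn_U b_def)
    finally show ?thesis .
  qed
  \<comment> \<open>Cauchy-Schwarz for one row of the difference of the square roots, written with
    rows in \<open>U\<close> and columns in \<open>V\<close>; the vector \<open>z\<close> has norm
    at most 1 because \<open>x\<close> has.\<close>
  have diff: "(a i - b i)\<^sup>2 \<le> (\<Sum>j<n. (?B i j)\<^sup>2 * (sqrt (p i) - sqrt (q j))\<^sup>2)" if "i < n" for i
  proof -
    have "a i - b i = (\<Sum>j<n. (?B i j * (sqrt (p i) - sqrt (q j))) * z j)"
      unfolding a_def b_def y[OF that] by (simp add: sum_distrib_left sum_subtractf algebra_simps)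
    then have "(a i - b i)\<^sup>2 \<le> (\<Sum>j<n. (?B i j * (sqrt (p i) - sqrt (q j)))\<^sup>2) * (\<Sum>j<n. (z j)\<^sup>2)"
      using sum_mult_power2_le[of "\<lambda>j. ?B i j * (sqrt (p i) - sqrt (q j))" z "{..<n}"] by simp
    also have "(\<Sum>j<n. (z j)\<^sup>2) \<le> 1"
      using parseval[OF assms(2) x(1)] x(2) by (simp add: z_def)
    finally show ?thesis
      by (simp add: mult_left_mono sum_nonneg power_mult_distrib)
  qed
  have "\<eta> / (1 + \<eta>) * quad_form (conj_diag n V q) x
      = (\<Sum>i<n. \<eta> / (1 + \<eta>) * (b i)\<^sup>2)"
    by (simp add: qb sum_distrib_left)
  also have "\<dots> \<le> (\<Sum>i<n. (a i - b i)\<^sup>2 + \<eta> * (a i)\<^sup>2)"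
  proof (rule sum_mono)
    \<comment> \<open>Completing the square. Equality holds at a = b / (1 + \<eta>), so the
      coefficient \<eta> / (1 + \<eta>) cannot be raised in this inequality.\<close>
    fix i
    have "(a i - b i)\<^sup>2 + \<eta> * (a i)\<^sup>2 - \<eta> / (1 + \<eta>) * (b i)\<^sup>2 = ((1 + \<eta>) * a i - b i)\<^sup>2 / (1 + \<eta>)"
      using \<eta> by (simp add: field_simps power2_eq_square)
    moreover have "\<dots> \<ge> 0" using \<eta> by simp
    ultimately show "\<eta> / (1 + \<eta>) * (b i)\<^sup>2 \<le> (a i - b i)\<^sup>2 + \<eta> * (a i)\<^sup>2" by linarith
  qed
  also have "\<dots> \<le> (\<Sum>i<n. \<Sum>j<n. (?B i j)\<^sup>2 * (sqrt (p i) - sqrt (q j))\<^sup>2) + \<eta> * quad_form (conj_diag n U p) x"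
    unfolding qa sum_distrib_left sum.distrib using diff by (intro add_right_mono sum_mono) simp
  also have "\<dots> \<le> rel_ent n (conj_diag n U p) (conj_diag n V q) + \<eta> * quad_form (conj_diag n U p) x"
    using rel_ent_ge_hellinger[OF assms(1-5)] by simp
  finally show ?thesis .
qed

section \<open>Capped density matrices and entropic projection\<close>

lemma conj_diag_mult:
  assumes "orth_mat n U"
  shows "conj_diag n U f * conj_diag n U g = conj_diag n U (\<lambda>i. f i * g i)"
proof -
  note U = orth_matD[OF assms]
  have "conj_diag n U f * conj_diag n U g
      = U * mat_diag n f * (transpose_mat U * U) * mat_diag n g * transpose_mat U"
    using U(1) by (simp add: conj_diag_def assoc_mult_mat[of _ n n _ n _ n] mult_carrier_mat[of _ n n _ n])
  also have "\<dots> = U * (mat_diag n f * mat_diag n g) * transpose_mat U"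
    unfolding U(2) using U(1)
    by (simp add: right_mult_one_mat[of _ n n] assoc_mult_mat[of _ n n _ n _ n] mult_carrier_mat[of _ n n _ n] del: mat_diag_diag)
  finally show ?thesis by (simp add: conj_diag_def)
qed

lemma conj_diag_smult:
  assumes "U \<in> carrier_mat n n"
  shows "c \<cdot>\<^sub>m conj_diag n U f = conj_diag n U (\<lambda>i. c * f i)"
  using assms by (intro eq_matI) (auto simp: conj_diag_index sum_distrib_left mult_ac)

lemma conj_diag_diff:
  assumes "U \<in> carrier_mat n n"
  shows "conj_diag n U f - conj_diag n U g = conj_diag n U (\<lambda>i. f i - g i)"
  using assms by (intro eq_matI) (auto simp: conj_diag_index sum_subtractf algebra_simps)

section \<open>The spectral norm in terms of eigenvalues\<close>

lemma vnorm_conj_diag_mult: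
  assumes U: "orth_mat n U" and v: "v \<in> carrier_vec n"
  shows "vnorm (conj_diag n U l *\<^sub>v v) = sqrt (\<Sum>k<n. (l k)\<^sup>2 * (col U k \<bullet> v)\<^sup>2)"
proof -
  note U' = orth_matD[OF U]
  let ?W = "conj_diag n U l"
  have W: "?W \<in> carrier_mat n n" using U' by simp
  have "(?W *\<^sub>v v) \<bullet> (?W *\<^sub>v v) = v \<bullet> (?W *\<^sub>v (?W *\<^sub>v v))"
    using symmetric_bilinear_swap[OF W transpose_conj_diag[OF U'(1)], of "?W *\<^sub>v v" v] W v by simp
  also have "\<dots> = quad_form (conj_diag n U (\<lambda>i. l i * l i)) v"
    using W v by (simp add: quad_form_def flip: conj_diag_mult[OF U])
  finally show ?thesis
    using U' v by (simp add: vnorm_def quad_form_conj_diag power2_eq_square)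
qed

lemma vnorm_conj_diag_le:
  assumes U: "orth_mat n U" and v: "v \<in> carrier_vec n" "vnorm v \<le> 1"
    and c: "0 \<le> c" "\<And>i. i < n \<Longrightarrow> \<bar>l i\<bar> \<le> c"
  shows "vnorm (conj_diag n U l *\<^sub>v v) \<le> c"
proof -
  have "(\<Sum>k<n. (l k)\<^sup>2 * (col U k \<bullet> v)\<^sup>2) \<le> (\<Sum>k<n. c\<^sup>2 * (col U k \<bullet> v)\<^sup>2)"
    using c by (intro sum_mono mult_right_mono) (auto intro!: power2_le_iff_abs_le[THEN iffD2])
  also have "\<dots> = c\<^sup>2 * (v \<bullet> v)"
    by (simp add: parseval[OF U v(1)] flip: sum_distrib_left)
  also have "\<dots> \<le> c\<^sup>2 * 1"
    using v(2) by (intro mult_left_mono) (auto simp: vnorm_def)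
  finally show ?thesis
    using c unfolding vnorm_conj_diag_mult[OF U v(1)] by (intro real_le_lsqrt) (auto intro!: sum_nonneg)
qed

lemma spec_norm_conj_diag_le:
  assumes U: "orth_mat n U" and c: "0 \<le> c" "\<And>i. i < n \<Longrightarrow> \<bar>l i\<bar> \<le> c"
  shows "spec_norm (conj_diag n U l) \<le> c"
proof -
  have "dim_row U = n" using orth_matD[OF U] by auto
  then show ?thesis
    unfolding spec_norm_def using vnorm_conj_diag_le[OF U _ _ c]
    by (intro cSup_least) (auto simp: vnorm_def intro!: exI[of _ "0\<^sub>v n"])
qed

lemma abs_eigenvalue_le_spec_norm:
  assumes U: "orth_mat n U" and i: "i < n"
  shows "\<bar>l i\<bar> \<le> spec_norm (conj_diag n U l)"
proof -
  note U' = orth_matD[OF U]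
  have dim: "dim_row U = n" using U' by auto
  have col: "col U i \<in> carrier_vec n" using U' i by auto
  have "(\<Sum>k<n. (l k)\<^sup>2 * (col U k \<bullet> col U i)\<^sup>2) = (\<Sum>k<n. if k = i then (l k)\<^sup>2 else 0)"
    using i by (intro sum.cong) (auto simp: orth_mat_col_inner[OF U])
  then have "\<bar>l i\<bar> = vnorm (conj_diag n U l *\<^sub>v col U i)"
    using i unfolding vnorm_conj_diag_mult[OF U col] by simp
  also have "\<dots> \<le> spec_norm (conj_diag n U l)"
    unfolding spec_norm_def
  proof (rule cSup_upper)
    show "vnorm (conj_diag n U l *\<^sub>v col U i) \<in> {vnorm (conj_diag n U l *\<^sub>v v) |v.
        v \<in> carrier_vec (dim_col (conj_diag n U l)) \<and> vnorm v \<le> 1}"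
      using col dim i by (auto simp: vnorm_def orth_mat_col_inner[OF U] intro!: exI[of _ "col U i"])
    \<comment> \<open>\<open>spec_norm\<close> is a supremum of reals, so an eigenvector gives a
      lower bound only once the set is known to be bounded. The sum of the absolute eigenvalues is a
      crude bound that suffices.\<close>
    have "\<bar>l k\<bar> \<le> (\<Sum>k<n. \<bar>l k\<bar>)" if "k < n" for k
      using that by (intro member_le_sum) auto
    then show "bdd_above {vnorm (conj_diag n U l *\<^sub>v v) |v.
        v \<in> carrier_vec (dim_col (conj_diag n U l)) \<and> vnorm v \<le> 1}"
      using vnorm_conj_diag_le[OF U, of _ "\<Sum>k<n. \<bar>l k\<bar>" l] dim
      by (intro bdd_aboveI[of _ "\<Sum>k<n. \<bar>l k\<bar>"]) (auto simp: sum_nonneg)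
  qed
  finally show ?thesis .
qed

section \<open>The capped set in terms of eigenvalues\<close>

lemma conj_diag_in_capped:
  assumes U: "orth_mat n U" and "\<And>i. i < n \<Longrightarrow> 0 \<le> l i" "\<And>i. i < n \<Longrightarrow> l i \<le> 1 / real m"
    and "(\<Sum>i<n. l i) = 1"
  shows "conj_diag n U l \<in> capped n m"
  using assms orth_matD[OF U] spec_norm_conj_diag_le[OF U, of "1 / real m" l]
    quad_form_conj_diag[of U n _ l]
  by (auto simp: capped_def sym_psd_def transpose_conj_diag mtrace_conj_diag quad_form_def
      intro!: sum_nonneg)

lemma in_cappedE:
  assumes "W \<in> capped n m"
  obtains U l where "orth_mat n U" "W = conj_diag n U l" "\<And>i. i < n \<Longrightarrow> 0 \<le> l i"
    "\<And>i. i < n \<Longrightarrow> l i \<le> 1 / real m" "(\<Sum>i<n. l i) = 1"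
proof -
  obtain U l where U: "orth_mat n U" and W: "W = conj_diag n U l"
    using symmetric_spectral assms by (force simp: capped_def sym_psd_def)
  have "0 \<le> l i" if "i < n" for i
    using quad_form_eigenvector[OF U that, of l] col_carrier_vec[OF that, of U n] orth_matD(1)[OF U] assms
    by (auto simp: capped_def sym_psd_def quad_form_def W dest!: bspec[of _ _ "col U i"])
  moreover have "l i \<le> 1 / real m" if "i < n" for i
    using abs_eigenvalue_le_spec_norm[OF U that, of l] assms by (auto simp: capped_def W)
  moreover have "(\<Sum>i<n. l i) = 1"
    using assms mtrace_conj_diag[OF U, of l] by (auto simp: capped_def W)
  ultimately show ?thesis using that U W by blast
qed

lemma capped_quad_form:
  assumes "W \<in> capped n m" "v \<in> carrier_vec n"
  shows "0 \<le> quad_form W v" "quad_form W v \<le> (v \<bullet> v) / real m"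
proof -
  obtain U l where U: "orth_mat n U" and W: "W = conj_diag n U l"
    and l: "\<And>i. i < n \<Longrightarrow> 0 \<le> l i" "\<And>i. i < n \<Longrightarrow> l i \<le> 1 / real m"
    using in_cappedE[OF assms(1)] by metis
  have q: "quad_form W v = (\<Sum>k<n. l k * (col U k \<bullet> v)\<^sup>2)"
    unfolding W by (rule quad_form_conj_diag[OF orth_matD(1)[OF U] assms(2)])
  show "0 \<le> quad_form W v" unfolding q using l by (intro sum_nonneg) auto
  have "quad_form W v \<le> (\<Sum>k<n. 1 / real m * (col U k \<bullet> v)\<^sup>2)"
    unfolding q using l by (intro sum_mono mult_right_mono) auto
  also have "\<dots> = (v \<bullet> v) / real m"
    by (simp add: parseval[OF U assms(2)] flip: sum_divide_distrib)
  finally show "quad_form W v \<le> (v \<bullet> v) / real m" .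
qed

lemma cappedD:
  assumes "W \<in> capped n m"
  shows "W \<in> carrier_mat n n" "mtrace W = 1"
  using assms by (auto simp: capped_def sym_psd_def)

lemma sum_quad_form_cols:
  assumes "orth_mat n U" "A \<in> carrier_mat n n"
  shows "(\<Sum>k<n. quad_form A (col U k)) = mtrace A"
  using mtrace_conj_diag_mult[OF assms(2) orth_matD(1)[OF assms(1)], of "\<lambda>_. 1"] assms
  by (simp add: conj_diag_one)

lemma mtrace_mult_mln:
  assumes "orth_mat n U" "A \<in> carrier_mat n n"
  shows "mtrace (A * mln n (conj_diag n U q)) = (\<Sum>k<n. ln (q k) * quad_form A (col U k))"
  using assms orth_matD(1)[OF assms(1)]
  by (simp add: mln_def mat_fun_conj_diag mtrace_conj_diag_mult)

text \<open>All eigenvalues lie in [0,1], so each term l ln l is at most 0. This allows the negative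
  entropy of the comparator to be dropped when its relative entropy is bounded from above.\<close>

lemma capped_trace_ln_nonpos:
  assumes "Q \<in> capped n m" "m > 0"
  shows "mtrace (Q * mln n Q) \<le> 0"
proof -
  obtain U l where U: "orth_mat n U" and Q: "Q = conj_diag n U l"
    and l: "\<And>i. i < n \<Longrightarrow> 0 \<le> l i" "\<And>i. i < n \<Longrightarrow> l i \<le> 1 / real m"
    using in_cappedE[OF assms(1)] by metis
  have "l i \<le> 1" if "i < n" for i
    using l(2)[OF that] assms(2) by (auto intro: order.trans simp: divide_le_eq)
  then have "ln (l i) * l i \<le> 0" if "i < n" for i
    using l(1)[OF that] that by (cases "l i = 0") (auto simp: mult_nonpos_nonneg)
  then show ?thesis
    using mtrace_mult_mln[OF U, of Q l] cappedD[OF assms(1)] U unfolding Q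
    by (auto simp: quad_form_eigenvector intro: sum_nonpos)
qed

text \<open>The entropic projection onto the capped set caps the rescaled spectrum; the multipliers
  of the caps are nonzero only where the cap is attained, which gives the Pythagorean inequality.\<close>

lemma capped_projection:
  assumes U: "orth_mat n U" and q: "\<And>i. i < n \<Longrightarrow> q i > 0" and m: "0 < m" "m \<le> n"
  shows "\<exists>s. (\<forall>i<n. s i > 0) \<and> (\<Sum>i<n. s i) = 1 \<and> conj_diag n U s \<in> capped n m \<and>
    (\<forall>Q\<in>capped n m. rel_ent n Q (conj_diag n U s) + rel_ent n (conj_diag n U s) (conj_diag n U q)
        \<le> rel_ent n Q (conj_diag n U q))"
proof -
  let ?f = "\<lambda>c. \<Sum>i<n. min (c * q i) (1 / real m)"
  \<comment> \<open>At the scale \<open>C\<close> every eigenvalue reaches the cap, so the capped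
    mass is n/m \<ge> 1; at scale 0 it is 0. The intermediate value theorem then gives a scale with
    mass exactly 1.\<close>
  define C where "C = (\<Sum>i<n. 1 / (real m * q i))"
  have C0: "0 \<le> C" using q by (auto simp: C_def less_imp_le intro!: sum_nonneg divide_nonneg_nonneg)
  have "1 / real m \<le> C * q i" if "i < n" for i
  proof -
    have "1 / (real m * q i) \<le> C"
      unfolding C_def using that q by (intro member_le_sum) (auto simp: less_imp_le)
    then show ?thesis using q[OF that] by (simp add: divide_le_eq field_simps)
  qed
  then have "?f C = (\<Sum>i<n. 1 / real m)"
    by (intro sum.cong) (auto simp: min_absorb2)
  also have "\<dots> \<ge> 1" using m by simp
  finally have "1 \<le> ?f C" .
  moreover have "?f 0 \<le> 1" by simp
  moreover have "continuous_on {0..C} ?f" by (intro continuous_intros)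
  ultimately obtain c where c: "0 \<le> c" "?f c = 1"
    using IVT'[of ?f 0 1 C] C0 by blast
  have c0: "c > 0" using c by (cases "c = 0") auto
  define s where "s i = min (c * q i) (1 / real m)" for i
  have s0: "s i > 0" if "i < n" for i using q[OF that] c0 m by (simp add: s_def)
  have s1: "(\<Sum>i<n. s i) = 1" using c by (simp add: s_def)
  have S: "conj_diag n U s \<in> capped n m"
    using U s0 s1 by (intro conj_diag_in_capped) (auto simp: less_imp_le s_def)
  \<comment> \<open>The term Tr (Q ln Q) cancels, so the difference of the two entropies is linear
    in Q.\<close>
  have gain: "rel_ent n Q (conj_diag n U q) - rel_ent n Q (conj_diag n U s)
      = (\<Sum>k<n. (ln (s k) - ln (q k)) * quad_form Q (col U k))" if "Q \<in> capped n m" for Q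
    unfolding rel_ent_def using cappedD[OF that]
    by (simp add: mtrace_mult_mln[OF U] left_diff_distrib sum_subtractf)
  have "rel_ent n Q (conj_diag n U s) + rel_ent n (conj_diag n U s) (conj_diag n U q)
        \<le> rel_ent n Q (conj_diag n U q)" if Q: "Q \<in> capped n m" for Q
  proof -
    let ?g = "\<lambda>k. ln (s k) - ln (q k)"
    \<comment> \<open>Complementary slackness. The multiplier ln c - (ln (s k) - ln (q k)) is zero
      where the cap is inactive. Elsewhere it is nonnegative and s k = 1/m, the largest value the
      quadratic form of Q can take at a unit vector.\<close>
    have le: "(ln c - ?g k) * quad_form Q (col U k) \<le> (ln c - ?g k) * s k" if k: "k < n" for k
    proof (cases "c * q k \<le> 1 / real m")
      case True
      then have "?g k = ln c" using c0 q[OF k] by (simp add: s_def ln_mult min_absorb1)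
      then show ?thesis by simp
    next
      case False
      then have sk: "s k = 1 / real m" by (simp add: s_def)
      have "ln (s k) \<le> ln (c * q k)" using s0[OF k] by (subst ln_le_cancel_iff) (auto simp: s_def c0 q[OF k])
      then have "ln c - ?g k \<ge> 0" using c0 q[OF k] by (simp add: ln_mult)
      moreover have "quad_form Q (col U k) \<le> s k"
        using capped_quad_form(2)[OF Q, of "col U k"] orth_matD(1)[OF U] k
        by (simp add: orth_mat_col_inner[OF U] sk)
      ultimately show ?thesis by (intro mult_left_mono)
    qed
    have "(\<Sum>k<n. (ln c - ?g k) * quad_form Q (col U k)) \<le> (\<Sum>k<n. (ln c - ?g k) * s k)"
      using le by (intro sum_mono) auto
    moreover have "(\<Sum>k<n. (ln c - ?g k) * quad_form Q (col U k)) = ln c - (\<Sum>k<n. ?g k * quad_form Q (col U k))"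
      using sum_quad_form_cols[OF U, of Q] cappedD[OF Q]
      by (simp add: left_diff_distrib[of "ln c"] sum_subtractf flip: sum_distrib_left)
    moreover have "(\<Sum>k<n. (ln c - ?g k) * s k) = ln c - (\<Sum>k<n. ?g k * s k)"
      using s1 by (simp add: left_diff_distrib[of "ln c"] sum_subtractf flip: sum_distrib_left)
    moreover have "rel_ent n (conj_diag n U s) (conj_diag n U q) = (\<Sum>k<n. ?g k * s k)"
      using gain[OF S] by (simp add: rel_ent_def quad_form_eigenvector[OF U])
    ultimately show ?thesis using gain[OF Q] by linarith
  qed
  with s0 s1 S show ?thesis by blast
qed

text \<open>The invariant of the iterates. Strict positivity matters because at a zero eigenvalue
  \<open>ln\<close> returns a default value, whereas the relative entropy to such a state should be
  infinite.\<close>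

definition pos_density :: "nat \<Rightarrow> real mat \<Rightarrow> bool" where
  "pos_density n W \<longleftrightarrow> (\<exists>U q. orth_mat n U \<and> W = conj_diag n U q \<and> (\<forall>i<n. 0 < q i) \<and> (\<Sum>i<n. q i) = 1)"

lemma pos_def_imp_pos_density:
  assumes "pos_def n W" "mtrace W = 1"
  shows "pos_density n W"
proof -
  obtain U q where U: "orth_mat n U" and W: "W = conj_diag n U q"
    using symmetric_spectral assms(1) by (force simp: pos_def_def)
  have "0 < q i" if "i < n" for i
  proof -
    have "col U i \<noteq> 0\<^sub>v n"
      using orth_mat_col_inner[OF U that that] by auto
    then show ?thesis
      using quad_form_eigenvector[OF U that, of q] col_carrier_vec[OF that, of U n] orth_matD(1)[OF U] assms(1)
      by (auto simp: pos_def_def quad_form_def W dest!: bspec[of _ _ "col U i"])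
  qed
  then show ?thesis
    using U W assms(2) by (auto simp: pos_density_def mtrace_conj_diag)
qed

lemma rel_ent_capped_nonneg:
  assumes "Q \<in> capped n m" "pos_density n W"
  shows "0 \<le> rel_ent n Q W"
proof -
  obtain V p where "orth_mat n V" "Q = conj_diag n V p" "\<And>i. i < n \<Longrightarrow> 0 \<le> p i" "(\<Sum>i<n. p i) = 1"
    using in_cappedE[OF assms(1)] by metis
  then show ?thesis
    using assms(2) by (auto simp: pos_density_def intro!: rel_ent_nonneg)
qed

text \<open>The Pythagorean inequality at the minimizer W, combined with its minimality against the
  explicit projection S, forces D(W, S) \<le> 0 and hence W = S. So every minimizer inherits
  positivity and the Pythagorean inequality from S; existence and uniqueness need no separate
  compactness or convexity argument.\<close>

lemma rel_ent_minimizer: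
  assumes W: "W \<in> capped n m" and A: "pos_density n A" and m: "0 < m" "m \<le> n"
    and min: "\<And>W'. W' \<in> capped n m \<Longrightarrow> rel_ent n W A \<le> rel_ent n W' A"
  shows "pos_density n W" "\<And>Q. Q \<in> capped n m \<Longrightarrow> rel_ent n Q W \<le> rel_ent n Q A"
proof -
  obtain U q where U: "orth_mat n U" and Aq: "A = conj_diag n U q" and q: "\<And>i. i < n \<Longrightarrow> 0 < q i"
    and q1: "(\<Sum>i<n. q i) = 1"
    using A by (auto simp: pos_density_def)
  obtain s where s: "\<forall>i<n. s i > 0" "(\<Sum>i<n. s i) = 1" and S: "conj_diag n U s \<in> capped n m"
    and pyth: "\<forall>Q\<in>capped n m. rel_ent n Q (conj_diag n U s) + rel_ent n (conj_diag n U s) A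
        \<le> rel_ent n Q A"
    using capped_projection[OF U _ m, of q] q unfolding Aq by blast
  have "rel_ent n W (conj_diag n U s) \<le> 0"
    using bspec[OF pyth W] min[OF S] by linarith
  moreover obtain V p where "orth_mat n V" "W = conj_diag n V p" "\<And>i. i < n \<Longrightarrow> 0 \<le> p i" "(\<Sum>i<n. p i) = 1"
    using in_cappedE[OF W] by metis
  ultimately have WS: "W = conj_diag n U s"
    using rel_ent_eq_imp_eq[of n V U p s] s U by auto
  then show "pos_density n W" using U s by (auto simp: pos_density_def)
  show "rel_ent n Q W \<le> rel_ent n Q A" if "Q \<in> capped n m" for Q
    using bspec[OF pyth that] rel_ent_capped_nonneg[OF S A] unfolding WS by linarith
qed

section \<open>One step of the algorithm\<close>

text \<open>With V the normalised exponential, the log-partition function is minus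
  rel_ent n V W + \<eta> * quad_form V x, so the measurement inequality bounds it.\<close>

lemma exponential_update:
  assumes W: "pos_density n W" and x: "x \<in> carrier_vec n" "x \<bullet> x \<le> 1" and \<eta>: "\<eta> > 0" and n: "n > 0"
  obtains V v where "orth_mat n V" "\<And>i. i < n \<Longrightarrow> v i > 0" "(\<Sum>i<n. v i) = 1"
    "(let M = mexp n (mln n W - \<eta> \<cdot>\<^sub>m outer x) in (1 / mtrace M) \<cdot>\<^sub>m M) = conj_diag n V v"
    "\<And>Q. Q \<in> capped n m \<Longrightarrow> rel_ent n Q (conj_diag n V v)
      \<le> rel_ent n Q W + \<eta> * quad_form Q x - \<eta> / (1 + \<eta>) * quad_form W x"
proof -
  obtain U q where U: "orth_mat n U" and Wq: "W = conj_diag n U q" and q: "\<And>i. i < n \<Longrightarrow> 0 < q i"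
    and q1: "(\<Sum>i<n. q i) = 1"
    using W by (auto simp: pos_density_def)
  note U' = orth_matD(1)[OF U]
  have X: "outer x \<in> carrier_mat n n" using x by (simp add: outer_def)
  have lnW: "mln n W = conj_diag n U (ln \<circ> q)"
    unfolding mln_def Wq by (rule mat_fun_conj_diag[OF U])
  then have lnWc: "mln n W \<in> carrier_mat n n" using U' by simp
  define H where "H = mln n W - \<eta> \<cdot>\<^sub>m outer x"
  have Hc: "H \<in> carrier_mat n n" using X by (simp add: H_def minus_carrier_mat)
  have "transpose_mat (mln n W) = mln n W"
    unfolding lnW by (rule transpose_conj_diag[OF U'])
  moreover have "transpose_mat (\<eta> \<cdot>\<^sub>m outer x) = \<eta> \<cdot>\<^sub>m outer x"
    by (intro eq_matI) (auto simp: outer_def)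
  ultimately have "transpose_mat H = H"
    using lnWc X by (simp add: H_def transpose_minus[of _ n n])
  then obtain V h where V: "orth_mat n V" and Hh: "H = conj_diag n V h"
    using symmetric_spectral[OF Hc] by blast
  note V' = orth_matD(1)[OF V]
  define Z where "Z = (\<Sum>i<n. exp (h i))"
  have Z: "Z > 0" unfolding Z_def using n by (intro sum_pos) auto
  define v where "v i = exp (h i) / Z" for i
  have v0: "v i > 0" for i using Z by (simp add: v_def)
  have v1: "(\<Sum>i<n. v i) = 1" using Z by (simp add: v_def Z_def flip: sum_divide_distrib)
  have M: "mexp n H = conj_diag n V (exp \<circ> h)"
    unfolding mexp_def Hh by (rule mat_fun_conj_diag[OF V])
  have norm: "(let M = mexp n (mln n W - \<eta> \<cdot>\<^sub>m outer x) in (1 / mtrace M) \<cdot>\<^sub>m M) = conj_diag n V v"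
    using M V' mtrace_conj_diag[OF V, of "exp \<circ> h"]
    by (simp add: conj_diag_smult v_def[abs_def] Z_def flip: H_def)
  \<comment> \<open>The logarithm of the normalized exponential is H - ln Z times the identity.
    Since Q has trace 1, the identity contributes exactly - ln Z.\<close>
  have trln: "mtrace (Q * mln n (conj_diag n V v)) = mtrace (Q * mln n W) - \<eta> * quad_form Q x - ln Z"
    if Q: "Q \<in> carrier_mat n n" "mtrace Q = 1" for Q
  proof -
    have "mtrace (Q * mln n (conj_diag n V v)) = (\<Sum>k<n. (h k - ln Z) * quad_form Q (col V k))"
      unfolding mtrace_mult_mln[OF V Q(1)] using Z by (simp add: v_def ln_div)
    also have "\<dots> = (\<Sum>k<n. h k * quad_form Q (col V k)) - ln Z"
      using sum_quad_form_cols[OF V Q(1)] Q(2)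
      by (simp add: left_diff_distrib sum_subtractf flip: sum_distrib_left)
    also have "(\<Sum>k<n. h k * quad_form Q (col V k)) = mtrace (Q * H)"
      unfolding Hh using mtrace_conj_diag_mult[OF Q(1) V'] by simp
    also have "mtrace (Q * H) = mtrace (Q * mln n W) - \<eta> * mtrace (Q * outer x)"
      using Q(1) lnWc X Hc
      by (simp add: mtrace_mult H_def right_diff_distrib sum_subtractf sum_distrib_left mult_ac)
    finally show ?thesis using Q(1) x(1) by (simp add: mtrace_outer[of _ n])
  qed
  have Vm: "conj_diag n V v \<in> carrier_mat n n" "mtrace (conj_diag n V v) = 1"
    using V' v1 by (auto simp: mtrace_conj_diag[OF V])
  have "\<eta> / (1 + \<eta>) * quad_form W x
      \<le> rel_ent n (conj_diag n V v) W + \<eta> * quad_form (conj_diag n V v) x"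
    unfolding Wq using v0 q v1 q1 x \<eta> by (intro rel_ent_measurement[OF V U]) (auto simp: less_imp_le)
  also have "\<dots> = - ln Z"
    using trln[OF Vm] by (simp add: rel_ent_def)
  finally have Zle: "\<eta> / (1 + \<eta>) * quad_form W x \<le> - ln Z" .
  have "rel_ent n Q (conj_diag n V v) \<le> rel_ent n Q W + \<eta> * quad_form Q x - \<eta> / (1 + \<eta>) * quad_form W x"
    if "Q \<in> capped n m" for Q
    using Zle trln[OF cappedD[OF that]] unfolding rel_ent_def by linarith
  then show ?thesis using that V v0 v1 norm by blast
qed

text \<open>Mixing changes the eigenvalues and keeps the eigenbasis, so both entropy estimates
  reduce to monotonicity of the scalar logarithm. The per-step bound uses u \<ge> (1 - \<alpha>) v;
  the bound independent of the history uses u \<ge> \<alpha>/n.\<close>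

lemma hat_update_bounds:
  assumes W: "pos_density n W" and x: "x \<in> carrier_vec n" "x \<bullet> x \<le> 1" and \<eta>: "\<eta> > 0"
    and n: "n > 0" and m: "m > 0" and \<alpha>: "0 < \<alpha>" "\<alpha> < 1"
  shows "pos_density n (hat_update n \<alpha> \<eta> W x)"
    and "Q \<in> capped n m \<Longrightarrow> rel_ent n Q (hat_update n \<alpha> \<eta> W x)
      \<le> rel_ent n Q W + \<eta> * quad_form Q x - \<eta> / (1 + \<eta>) * quad_form W x - ln (1 - \<alpha>)"
    and "Q \<in> capped n m \<Longrightarrow> rel_ent n Q (hat_update n \<alpha> \<eta> W x) \<le> ln (real n / \<alpha>)"
proof -
  obtain V v where V: "orth_mat n V" and v: "\<And>i. i < n \<Longrightarrow> v i > 0" "(\<Sum>i<n. v i) = 1"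
    and norm: "(let M = mexp n (mln n W - \<eta> \<cdot>\<^sub>m outer x) in (1 / mtrace M) \<cdot>\<^sub>m M) = conj_diag n V v"
    and step: "\<And>Q. Q \<in> capped n m \<Longrightarrow> rel_ent n Q (conj_diag n V v)
      \<le> rel_ent n Q W + \<eta> * quad_form Q x - \<eta> / (1 + \<eta>) * quad_form W x"
    using exponential_update[OF W x \<eta> n, of m] by blast
  define u where "u i = \<alpha> / real n + (1 - \<alpha>) * v i" for i
  have hat: "hat_update n \<alpha> \<eta> W x = conj_diag n V u"
    using norm mat_fun_conj_diag[OF V, of "\<lambda>v. \<alpha> / real n + (1 - \<alpha>) * v" v]
    by (simp add: hat_update_def Let_def u_def[abs_def] comp_def)
  have u_mix: "(1 - \<alpha>) * v i \<le> u i" and u_unif: "\<alpha> / real n \<le> u i" and u0: "u i > 0"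
    if "i < n" for i
    using v(1)[OF that] \<alpha> n by (auto simp: u_def add_pos_pos)
  have u1: "(\<Sum>i<n. u i) = 1"
    using v(2) n by (simp add: u_def sum.distrib flip: sum_distrib_left)
  show "pos_density n (hat_update n \<alpha> \<eta> W x)"
    unfolding hat pos_density_def using V u0 u1 by blast
  have qf: "0 \<le> quad_form Q (col V k)" if "Q \<in> capped n m" "k < n" for Q k
    using capped_quad_form(1)[OF that(1)] orth_matD(1)[OF V] that(2) by auto
  have tr: "(\<Sum>k<n. quad_form Q (col V k)) = 1" if "Q \<in> capped n m" for Q
    using sum_quad_form_cols[OF V] cappedD[OF that] by simp
  show "rel_ent n Q (hat_update n \<alpha> \<eta> W x)
      \<le> rel_ent n Q W + \<eta> * quad_form Q x - \<eta> / (1 + \<eta>) * quad_form W x - ln (1 - \<alpha>)"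
    if Q: "Q \<in> capped n m"
  proof -
    have "(\<Sum>k<n. (ln (1 - \<alpha>) + ln (v k)) * quad_form Q (col V k)) \<le> (\<Sum>k<n. ln (u k) * quad_form Q (col V k))"
    proof (intro sum_mono mult_right_mono)
      fix k assume "k \<in> {..<n}"
      then have k: "k < n" by simp
      have "ln (1 - \<alpha>) + ln (v k) = ln ((1 - \<alpha>) * v k)"
        using \<alpha> v(1)[OF k] by (simp add: ln_mult)
      also have "\<dots> \<le> ln (u k)"
        using \<alpha> v(1)[OF k] u_mix[OF k] u0[OF k] by (subst ln_le_cancel_iff) auto
      finally show "ln (1 - \<alpha>) + ln (v k) \<le> ln (u k)" .
      show "0 \<le> quad_form Q (col V k)" by (rule qf[OF Q k])
    qed
    then have "ln (1 - \<alpha>) + mtrace (Q * mln n (conj_diag n V v)) \<le> mtrace (Q * mln n (conj_diag n V u))"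
      using tr[OF Q] cappedD[OF Q]
      by (simp add: mtrace_mult_mln[OF V] distrib_right sum.distrib flip: sum_distrib_left)
    then show ?thesis
      using step[OF Q] unfolding hat rel_ent_def by linarith
  qed
  show "rel_ent n Q (hat_update n \<alpha> \<eta> W x) \<le> ln (real n / \<alpha>)" if Q: "Q \<in> capped n m"
  proof -
    have "ln (\<alpha> / real n) \<le> ln (u k)" if "k < n" for k
      using \<alpha> n u_unif[OF that] u0[OF that] by (subst ln_le_cancel_iff) auto
    then have "(\<Sum>k<n. ln (\<alpha> / real n) * quad_form Q (col V k)) \<le> (\<Sum>k<n. ln (u k) * quad_form Q (col V k))"
      using qf[OF Q] by (intro sum_mono mult_right_mono) auto
    then have "ln (\<alpha> / real n) \<le> mtrace (Q * mln n (conj_diag n V u))"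
      using tr[OF Q] cappedD[OF Q] by (simp add: mtrace_mult_mln[OF V] flip: sum_distrib_left)
    then show ?thesis
      using capped_trace_ln_nonpos[OF Q m] \<alpha> n unfolding hat rel_ent_def
      by (simp add: ln_div)
  qed
qed

lemma mult_sum_list_distrib:
  "(\<Sum>k<n. (\<Sum>(p, r) \<leftarrow> xs. p * r k) * a k) = (\<Sum>(p, r) \<leftarrow> xs. p * (\<Sum>k<n. r k * a k :: real))"
proof (induction xs)
  case (Cons y xs)
  then show ?case
    by (cases y) (simp add: distrib_right sum.distrib mult.assoc flip: sum_distrib_left)
qed simp

text \<open>The loss of a sampled projection is linear in the vertex \<open>r\<close>, so averaging
  over \<open>mix\<close> replaces \<open>r\<close> by \<open>w\<close>. This removes the randomness
  from the rest of the analysis.\<close>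

lemma exp_loss_eq:
  assumes d: "valid_decomp n k W Db w mix" and x: "x \<in> carrier_vec n"
  shows "exp_loss n k Db mix x = real (n - k) * quad_form W x"
proof -
  have D: "orth_mat n Db" and W: "W = conj_diag n Db w"
    and w: "\<And>i. i < n \<Longrightarrow> w i = (\<Sum>(p, r) \<leftarrow> mix. p * r i)"
    using d by (auto simp: valid_decomp_def conj_diag_def)
  note D' = orth_matD(1)[OF D]
  have one: "mtrace ((1\<^sub>m n - played_proj n k Db r) * outer x)
      = real (n - k) * (\<Sum>i<n. r i * (col Db i \<bullet> x)\<^sup>2)" for r
  proof -
    have "1\<^sub>m n - played_proj n k Db r = conj_diag n Db (\<lambda>i. real (n - k) * r i)"
      using D' unfolding played_proj_def conj_diag_def[symmetric] conj_diag_smult[OF D']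
      by (intro eq_matI) auto
    then show ?thesis
      using D' x by (simp add: mtrace_outer[of _ n] quad_form_conj_diag sum_distrib_left mult.assoc)
  qed
  have "exp_loss n k Db mix x = real (n - k) * (\<Sum>(p, r) \<leftarrow> mix. p * (\<Sum>i<n. r i * (col Db i \<bullet> x)\<^sup>2))"
    unfolding exp_loss_def one by (induction mix) (auto simp: algebra_simps)
  also have "\<dots> = real (n - k) * quad_form W x"
    unfolding W quad_form_conj_diag[OF D' x] by (simp add: w flip: mult_sum_list_distrib)
  finally show ?thesis .
qed

section \<open>Projection matrices\<close>

text \<open>The transpose of \<open>A\<close> is a left inverse of \<open>A\<close>. Hence
  \<open>A\<close> is injective, its columns are independent, and A A' has the same column space as
  \<open>A\<close>.\<close>

lemma rank_mult_transpose_orthonormal: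
  fixes A :: "real mat"
  assumes A: "A \<in> carrier_mat n c" and orth: "transpose_mat A * A = 1\<^sub>m c"
  shows "vec_space.rank n (A * transpose_mat A) = c"
proof -
  interpret vec_space "TYPE(real)" n .
  let ?P = "A * transpose_mat A"
  have P: "?P \<in> carrier_mat n n" using A by simp
  have inv: "transpose_mat A *\<^sub>v (A *\<^sub>v v) = v" if "v \<in> carrier_vec c" for v
  proof -
    have "transpose_mat A *\<^sub>v (A *\<^sub>v v) = (transpose_mat A * A) *\<^sub>v v"
      using A that by (simp add: assoc_mult_mat_vec[of _ c n _ c])
    then show ?thesis using orth that by simp
  qed
  have PA: "?P *\<^sub>v v = A *\<^sub>v (transpose_mat A *\<^sub>v v)" if "v \<in> carrier_vec n" for v
    using A that by (simp add: assoc_mult_mat_vec[of _ n c _ n])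
  have "distinct (cols A)"
    unfolding distinct_conv_nth
  proof (intro allI impI)
    fix i j assume ij: "i < length (cols A)" "j < length (cols A)" "i \<noteq> j"
    have "col A i \<bullet> col A j = 0" "col A i \<bullet> col A i = 1"
      using ij A arg_cong[OF orth, of "\<lambda>M. M $$ (i, j)"] arg_cong[OF orth, of "\<lambda>M. M $$ (i, i)"] by auto
    then show "cols A ! i \<noteq> cols A ! j" using ij by auto
  qed
  moreover have "lin_indpt (set (cols A))"
  proof
    assume "lin_dep (set (cols A))"
    then obtain v where "v \<in> carrier_vec c" "v \<noteq> 0\<^sub>v c" "A *\<^sub>v v = 0\<^sub>v n"
      using lin_depE[OF A _ \<open>distinct (cols A)\<close>] by blast
    then show False using inv[of v] A by auto
  qed
  ultimately have "rank A = c" by (rule lin_indpt_full_rank[OF A])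
  moreover have "col_space ?P = col_space A"
  proof -
    have "{y\<in>carrier_vec n. \<exists>x\<in>carrier_vec n. ?P *\<^sub>v x = y} = {y\<in>carrier_vec n. \<exists>x\<in>carrier_vec c. A *\<^sub>v x = y}"
      (is "?L = ?R")
    proof (intro equalityI subsetI)
      fix y assume "y \<in> ?L"
      then obtain x where "y \<in> carrier_vec n" "x \<in> carrier_vec n" "A *\<^sub>v (transpose_mat A *\<^sub>v x) = y"
        using PA by auto
      then show "y \<in> ?R" using A by (auto intro!: bexI[of _ "transpose_mat A *\<^sub>v x"])
    next
      fix y assume "y \<in> ?R"
      then obtain x where "y \<in> carrier_vec n" "x \<in> carrier_vec c" "A *\<^sub>v x = y" by auto
      then show "y \<in> ?L" using A PA[of y] inv[of x] by (auto intro!: bexI[of _ y])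
    qed
    then show ?thesis
      using col_space_eq[OF A] col_space_eq[OF P] A by simp
  qed
  ultimately show ?thesis
    by (simp add: rank_def col_space_def)
qed

lemma rank_conj_diag_binary:
  assumes V: "orth_mat n V" and l: "\<And>i. i < n \<Longrightarrow> l i = 0 \<or> l i = 1"
  shows "real (vec_space.rank n (conj_diag n V l)) = (\<Sum>i<n. l i)"
proof -
  note V' = orth_matD(1)[OF V]
  \<comment> \<open>The indices of the eigenvalue 1. The corresponding eigenvectors form the columns
    of \<open>A\<close>, so that A A' is the spectral sum restricted to them.\<close>
  define js where "js = filter (\<lambda>i. l i = 1) [0..<n]"
  define A where "A = mat_of_cols n (map (col V) js)"
  have A: "A \<in> carrier_mat n (length js)"
    unfolding A_def using mat_of_cols_carrier(1)[of n "map (col V) js"] by simp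
  have js: "js ! i < n" if "i < length js" for i
    using nth_mem[OF that] by (simp add: js_def)
  have colA: "col A i = col V (js ! i)" if "i < length js" for i
    using that js[OF that] V' by (simp add: A_def col_mat_of_cols)
  have dist: "distinct js" by (simp add: js_def)
  have "transpose_mat A * A = 1\<^sub>m (length js)"
    using A dist by (intro eq_matI)
      (auto simp: colA orth_mat_col_inner[OF V] js nth_eq_iff_index_eq)
  moreover have "A * transpose_mat A = conj_diag n V l"
  proof (rule eq_matI)
    fix i j assume "i < dim_row (conj_diag n V l)" "j < dim_col (conj_diag n V l)"
    then have ij: "i < n" "j < n" using V' by auto
    have "(A * transpose_mat A) $$ (i, j) = (\<Sum>k<length js. V $$ (i, js ! k) * V $$ (j, js ! k))"
      using ij A js V' by (auto simp: scalar_prod_def atLeast0LessThan A_def mat_of_cols_def intro!: sum.cong)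
    also have "\<dots> = (\<Sum>k\<in>set js. V $$ (i, k) * V $$ (j, k))"
      using sum.reindex_bij_betw[OF bij_betw_nth[OF dist refl refl]] by simp
    also have "\<dots> = (\<Sum>k<n. V $$ (i, k) * l k * V $$ (j, k))"
      by (intro sum.mono_neutral_cong_left) (use l in \<open>auto simp: js_def\<close>)
    finally show "(A * transpose_mat A) $$ (i, j) = conj_diag n V l $$ (i, j)"
      by (simp add: conj_diag_index[OF V' ij])
  qed (use A V' in auto)
  ultimately have "vec_space.rank n (conj_diag n V l) = length js"
    using rank_mult_transpose_orthonormal[OF A] by simp
  also have "\<dots> = card (set js)"
    using dist by (simp add: distinct_card)
  finally have "real (vec_space.rank n (conj_diag n V l)) = (\<Sum>k\<in>set js. 1)" by simp
  also have "\<dots> = (\<Sum>k<n. l k)"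
    by (intro sum.mono_neutral_cong_left) (use l in \<open>auto simp: js_def\<close>)
  finally show ?thesis .
qed

text \<open>Idempotence forces l^2 = l for each eigenvalue, and the rank counts the ones. The rank
  condition thus becomes a condition on the trace, which is what membership in the capped set asks
  for.\<close>

lemma in_proj_setE:
  assumes "P \<in> proj_set n k"
  obtains V l where "orth_mat n V" "P = conj_diag n V l" "\<And>i. i < n \<Longrightarrow> l i = 0 \<or> l i = 1"
    "(\<Sum>i<n. l i) = real k"
proof -
  obtain V l where V: "orth_mat n V" and P: "P = conj_diag n V l"
    using symmetric_spectral assms by (force simp: proj_set_def)
  have "conj_diag n V (\<lambda>i. l i * l i) = conj_diag n V l"
    using assms by (simp add: proj_set_def P conj_diag_mult[OF V])
  then have "l i * l i = l i" if "i < n" for i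
    using quad_form_eigenvector[OF V that] by metis
  then have l: "l i = 0 \<or> l i = 1" if "i < n" for i
    using that by force
  have "(\<Sum>i<n. l i) = real (vec_space.rank n P)"
    unfolding P using rank_conj_diag_binary[OF V, of l] l by simp
  then have "(\<Sum>i<n. l i) = real k"
    using assms by (simp add: proj_set_def)
  with that V P l show ?thesis by blast
qed

text \<open>A lower bound for a real infimum needs a nonempty index set. A coordinate projection is
  a witness.\<close>

lemma proj_set_nonempty:
  assumes "k \<le> n"
  shows "proj_set n k \<noteq> {}"
proof -
  let ?l = "\<lambda>i. if i < k then 1 else 0 :: real"
  let ?P = "conj_diag n (1\<^sub>m n) ?l"
  have "real (vec_space.rank n ?P) = (\<Sum>i<n. ?l i)"
    by (rule rank_conj_diag_binary[OF orth_mat_one]) auto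
  also have "\<dots> = (\<Sum>i<k. 1)"
    using assms by (intro sum.mono_neutral_cong_right) auto
  finally have "vec_space.rank n ?P = k" by simp
  moreover have "?P * ?P = ?P"
    unfolding conj_diag_mult[OF orth_mat_one] by (rule conj_diag_cong) auto
  ultimately have "?P \<in> proj_set n k"
    by (simp add: proj_set_def transpose_conj_diag)
  then show ?thesis by blast
qed

text \<open>The complement has eigenvalues 0 and 1, with 1 occurring n - k times, so scaling by
  1/(n-k) gives trace 1 and meets the cap. The capped set is therefore a relaxation of the
  comparator class of projections.\<close>

lemma proj_complement_in_capped:
  assumes P: "P \<in> proj_set n k" and k: "k < n"
  shows "(1 / real (n - k)) \<cdot>\<^sub>m (1\<^sub>m n - P) \<in> capped n (n - k)"
proof -
  obtain V l where V: "orth_mat n V" and Pl: "P = conj_diag n V l"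
    and l: "\<And>i. i < n \<Longrightarrow> l i = 0 \<or> l i = 1" "(\<Sum>i<n. l i) = real k"
    using in_proj_setE[OF P] by metis
  note V' = orth_matD(1)[OF V]
  have "(1 / real (n - k)) \<cdot>\<^sub>m (1\<^sub>m n - P) = conj_diag n V (\<lambda>i. (1 - l i) / real (n - k))"
    unfolding Pl conj_diag_one[OF V, symmetric] conj_diag_diff[OF V'] conj_diag_smult[OF V'] by simp
  moreover have "conj_diag n V (\<lambda>i. (1 - l i) / real (n - k)) \<in> capped n (n - k)"
  proof (rule conj_diag_in_capped[OF V])
    show "(\<Sum>i<n. (1 - l i) / real (n - k)) = 1"
      using l(2) k by (simp add: sum_subtractf of_nat_diff flip: sum_divide_distrib)
  qed (use l(1) k in \<open>force simp: divide_simps\<close>)+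
  ultimately show ?thesis by simp
qed

section \<open>The adaptive regret bound\<close>

text \<open>The entropies telescope. \<open>next_le\<close> is assumed only for t < s because the
  last round stops at the mixed matrix, before the projection: no iterate after round T is given,
  and the final entropy is dropped as nonnegative anyway.\<close>

lemma adaptive_step_sum:
  assumes n: "n > 0" and m: "m > 0" and \<alpha>: "0 < \<alpha>" "\<alpha> < 1" and \<eta>: "\<eta> > 0" and rs: "r \<le> s"
    and x: "\<And>t. r \<le> t \<Longrightarrow> t \<le> s \<Longrightarrow> x t \<in> carrier_vec n \<and> x t \<bullet> x t \<le> 1"
    and W: "\<And>t. r \<le> t \<Longrightarrow> t \<le> s \<Longrightarrow> pos_density n (W t)"
    and next_le: "\<And>t. r \<le> t \<Longrightarrow> t < s \<Longrightarrow>
      rel_ent n Q (W (Suc t)) \<le> rel_ent n Q (hat_update n \<alpha> \<eta> (W t) (x t))"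
    and Q: "Q \<in> capped n m"
  shows "\<eta> / (1 + \<eta>) * (\<Sum>t=r..s. quad_form (W t) (x t))
    \<le> rel_ent n Q (W r) + \<eta> * (\<Sum>t=r..s. quad_form Q (x t)) - real (s - r + 1) * ln (1 - \<alpha>)"
proof -
  let ?hat = "\<lambda>t. hat_update n \<alpha> \<eta> (W t) (x t)"
  let ?c = "\<eta> / (1 + \<eta>)"
  have step: "rel_ent n Q (?hat t)
      \<le> rel_ent n Q (W t) + \<eta> * quad_form Q (x t) - ?c * quad_form (W t) (x t) - ln (1 - \<alpha>)"
    if "r \<le> t" "t \<le> s" for t
    using hat_update_bounds(2)[OF W[OF that] _ _ \<eta> n m \<alpha> Q] x[OF that] by blast
  have "rel_ent n Q (?hat (r + j)) \<le> rel_ent n Q (W r) + \<eta> * (\<Sum>t=r..r+j. quad_form Q (x t))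
      - ?c * (\<Sum>t=r..r+j. quad_form (W t) (x t)) - real (j + 1) * ln (1 - \<alpha>)" if "r + j \<le> s" for j
    using that
  proof (induction j)
    case 0
    then show ?case using step[of r] by simp
  next
    case (Suc j)
    have "rel_ent n Q (W (r + Suc j)) \<le> rel_ent n Q (?hat (r + j))"
      using next_le[of "r + j"] Suc.prems by simp
    then show ?case
      using Suc.IH step[of "r + Suc j"] Suc.prems by (simp add: algebra_simps)
  qed
  from this[of "s - r"] have "rel_ent n Q (?hat s) \<le> rel_ent n Q (W r) + \<eta> * (\<Sum>t=r..s. quad_form Q (x t))
      - ?c * (\<Sum>t=r..s. quad_form (W t) (x t)) - real (s - r + 1) * ln (1 - \<alpha>)"
    using rs by simp
  moreover have "0 \<le> rel_ent n Q (?hat s)"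
    using hat_update_bounds(1)[OF W[of s] _ _ \<eta> n m \<alpha>] x[of s] rs rel_ent_capped_nonneg[OF Q] by blast
  ultimately show ?thesis by linarith
qed

text \<open>With p = T(n-k) the mixing rate is 1/(p + 1), and -ln (1 - 1/(p + 1)) = ln (1 + 1/p)
  \<le> 1/p. So the mixing costs over all rounds, weighted by n - k, add up to at most 1.\<close>

lemma mult_neg_ln_le_one:
  fixes p :: real
  assumes "p > 0"
  shows "p * (- ln (1 - 1 / (p + 1))) \<le> 1"
proof -
  have "1 - 1 / (p + 1) = p / (p + 1)" using assms by (simp add: field_simps)
  then have "- ln (1 - 1 / (p + 1)) = ln ((p + 1) / p)" using assms by (simp add: ln_div)
  also have "\<dots> \<le> (p + 1) / p - 1" using assms by (intro ln_le_minus_one) simp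
  also have "\<dots> = 1 / p" using assms by (simp add: field_simps)
  finally show ?thesis using assms by (simp add: field_simps)
qed

lemma rescale_rate:
  fixes \<eta> X Y D :: real
  assumes "\<eta> > 0" "\<eta> / (1 + \<eta>) * X \<le> \<eta> * Y + D"
  shows "X \<le> (1 + \<eta>) * (Y + D / \<eta>)"
proof -
  have "X = (1 + \<eta>) / \<eta> * (\<eta> / (1 + \<eta>) * X)" using assms(1) by simp
  also have "\<dots> \<le> (1 + \<eta>) / \<eta> * (\<eta> * Y + D)"
    using assms by (intro mult_left_mono) auto
  also have "\<dots> = (1 + \<eta>) * (Y + D / \<eta>)" using assms(1) by (simp add: field_simps)
  finally show ?thesis .
qed

text \<open>For y = sqrt (2D/L) one has y L = sqrt (2LD) and D/y = y L / 2, while y/(1+y) \<le> ln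
  (1+y) \<le> y. So the left side is at most 1 + (3/2) y L + 2D, and D \<ge> 1 absorbs the leading
  1.\<close>

lemma tuned_rate_bound:
  fixes D L :: real
  assumes D: "1 \<le> D" and L: "0 < L" and \<eta>: "\<eta> = ln (1 + sqrt (2 * D / L))"
  shows "1 + \<eta> * L + (1 + \<eta>) * (D / \<eta>) \<le> 3 * (sqrt (2 * L * D) + D)"
proof -
  define y where "y = sqrt (2 * D / L)"
  have y: "y > 0" using D L by (simp add: y_def)
  have \<eta>y: "\<eta> = ln (1 + y)" by (simp only: \<eta> y_def)
  have \<eta>0: "\<eta> > 0" using y by (simp add: \<eta>y)
  have yL: "y * L = sqrt (2 * L * D)"
  proof -
    have "y * L = sqrt (2 * D / L) * sqrt (L * L)" using L by (simp add: y_def)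
    also have "\<dots> = sqrt (2 * D / L * (L * L))" by (simp only: real_sqrt_mult)
    also have "2 * D / L * (L * L) = 2 * L * D" using L by simp
    finally show ?thesis .
  qed
  have "y * y = 2 * D / L" using D L by (simp add: y_def)
  then have "y * (y * L) = 2 * D" using L by (simp add: field_simps)
  then have Dy: "D / y = y * L / 2" using y by (simp add: field_simps)
  have "\<eta> \<le> y" using y ln_add_one_self_le_self[of y] by (simp add: \<eta>y)
  then have "\<eta> * L \<le> y * L" using L by (intro mult_right_mono) auto
  moreover have "D / \<eta> \<le> D + D / y"
  proof -
    have "ln (1 / (1 + y)) \<le> 1 / (1 + y) - 1" using y by (intro ln_le_minus_one) simp
    then have "y / (1 + y) \<le> \<eta>" using y by (simp add: \<eta>y ln_div field_simps)
    then have "D / \<eta> \<le> D / (y / (1 + y))"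
      using y D \<eta>0 by (intro divide_left_mono) auto
    then show ?thesis using y by (simp add: field_simps)
  qed
  moreover have "y * L \<ge> 0" using y L by simp
  ultimately have "1 + \<eta> * L + (D / \<eta> + D) \<le> 3 * (y * L + D)"
    using D unfolding Dy by argo
  moreover have "(1 + \<eta>) * (D / \<eta>) = D / \<eta> + D" using \<eta>0 by (simp add: field_simps)
  ultimately show ?thesis using yL by simp
qed

theorem theorem4p3:
  "\<exists>C::real. \<forall>(n::nat) (k::nat) (T::nat) (x::nat \<Rightarrow> real vec) (L::real)
      (W::nat \<Rightarrow> real mat) (Db::nat \<Rightarrow> real mat) (w::nat \<Rightarrow> nat \<Rightarrow> real)
      (mix::nat \<Rightarrow> (real \<times> (nat \<Rightarrow> real)) list).
     1 \<le> k \<and> k < n \<and> 1 \<le> T \<and>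
     (\<forall>t. 1 \<le> t \<and> t \<le> T \<longrightarrow> x t \<in> carrier_vec n \<and> vnorm (x t) \<le> 1) \<and>
     W 1 \<in> capped n (n - k) \<and> pos_def n (W 1) \<and>
     (\<forall>t. 1 \<le> t \<and> t < T \<longrightarrow>
        W (t + 1) \<in> capped n (n - k) \<and>
        (\<forall>W' \<in> capped n (n - k).
           rel_ent n (W (t + 1)) (hat_update n (alpha_par n k T) (eta_par n k T L) (W t) (x t))
           \<le> rel_ent n W' (hat_update n (alpha_par n k T) (eta_par n k T L) (W t) (x t)))) \<and>
     (\<forall>t. 1 \<le> t \<and> t \<le> T \<longrightarrow> valid_decomp n k (W t) (Db t) (w t) (mix t)) \<and>
     0 < L \<and>
     (\<forall>r s. 1 \<le> r \<and> r \<le> s \<and> s \<le> T \<longrightarrow>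
        (INF Q\<in>capped n (n - k). \<Sum>t=r..s. real (n - k) * mtrace (Q * outer (x t))) \<le> L)
     \<longrightarrow>
     (\<forall>r s. 1 \<le> r \<and> r \<le> s \<and> s \<le> T \<longrightarrow>
        (\<Sum>t=r..s. exp_loss n k (Db t) (mix t) (x t))
        - (INF U\<in>proj_set n k. \<Sum>t=r..s. mtrace ((1\<^sub>m n - U) * outer (x t)))
        \<le> C * (sqrt (2 * L * D_par n k T) + D_par n k T))"
\<comment> \<open>The constant 3 is the one from \<open>tuned_rate_bound\<close>.\<close>
proof (intro exI[of _ 3] allI impI, elim conjE)
  fix n k T :: nat and x :: "nat \<Rightarrow> real vec" and L :: real and W Db :: "nat \<Rightarrow> real mat"
    and w :: "nat \<Rightarrow> nat \<Rightarrow> real" and mix :: "nat \<Rightarrow> (real \<times> (nat \<Rightarrow> real)) list" and r s :: nat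
  let ?\<alpha> = "alpha_par n k T" and ?\<eta> = "eta_par n k T L" and ?D = "D_par n k T" and ?m = "n - k"
  let ?hat = "\<lambda>t. hat_update n ?\<alpha> ?\<eta> (W t) (x t)"
  assume k: "1 \<le> k" "k < n" and T: "1 \<le> T"
    and x_asm: "\<forall>t. 1 \<le> t \<and> t \<le> T \<longrightarrow> x t \<in> carrier_vec n \<and> vnorm (x t) \<le> 1"
    and W1: "W 1 \<in> capped n ?m" "pos_def n (W 1)"
    and upd: "\<forall>t. 1 \<le> t \<and> t < T \<longrightarrow> W (t + 1) \<in> capped n ?m \<and>
        (\<forall>W' \<in> capped n ?m. rel_ent n (W (t + 1)) (?hat t) \<le> rel_ent n W' (?hat t))"
    and decomp: "\<forall>t. 1 \<le> t \<and> t \<le> T \<longrightarrow> valid_decomp n k (W t) (Db t) (w t) (mix t)"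
    and L: "0 < L"
    and L_bound: "\<forall>r s. 1 \<le> r \<and> r \<le> s \<and> s \<le> T \<longrightarrow>
        (INF Q\<in>capped n ?m. \<Sum>t=r..s. real ?m * mtrace (Q * outer (x t))) \<le> L"
    and rs: "1 \<le> r" "r \<le> s" "s \<le> T"
  \<comment> \<open>Keeps \<open>real (n - k)\<close> as a single factor in the arithmetic
    below.\<close>
  note [simp del] = of_nat_diff
  have n: "n > 0" and m: "?m > 0" "?m \<le> n" using k by auto
  have mT: "real T * real ?m > 0" using m T by simp
  then have \<alpha>: "0 < ?\<alpha>" "?\<alpha> < 1" by (auto simp: alpha_par_def)
  have "1 * 1 \<le> real n * (1 + real ?m * real T)"
    using n mT by (intro mult_mono) (auto simp: mult.commute)
  then have lnD: "0 \<le> ln (real n * (1 + real ?m * real T))" by simp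
  then have D: "1 \<le> ?D" by (simp add: D_par_def)
  have "0 < sqrt (2 * ?D / L)" using D L by simp
  then have \<eta>: "?\<eta> > 0" unfolding eta_par_def by (intro ln_gt_zero) linarith
  have x: "x t \<in> carrier_vec n" "x t \<bullet> x t \<le> 1" if "1 \<le> t" "t \<le> T" for t
    using x_asm that by (auto simp: vnorm_def)
  have tr: "mtrace (A * outer (x t)) = quad_form A (x t)" if "A \<in> carrier_mat n n" "1 \<le> t" "t \<le> T" for A t
    using mtrace_outer[OF that(1) x(1)[OF that(2,3)]] .
  have Wt: "W t \<in> capped n ?m \<and> pos_density n (W t)" if "1 \<le> t" "t \<le> T" for t
    using that
  proof (induction t rule: dec_induct)
    case base
    then show ?case using W1 pos_def_imp_pos_density cappedD(2)[OF W1(1)] by auto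
  next
    case (step t)
    then have "pos_density n (?hat t)"
      using hat_update_bounds(1)[OF _ x \<eta> n m(1) \<alpha>, of "W t" t] by auto
    then show ?case
      using upd step.hyps step.prems rel_ent_minimizer(1)[of "W (t + 1)" n ?m "?hat t"] m by auto
  qed
  have next_le: "rel_ent n Q (W (Suc t)) \<le> rel_ent n Q (?hat t)"
    if "1 \<le> t" "t < T" "Q \<in> capped n ?m" for Q t
    using upd that hat_update_bounds(1)[OF _ x \<eta> n m(1) \<alpha>, of "W t" t] Wt[of t]
      rel_ent_minimizer(2)[of "W (t + 1)" n ?m "?hat t" Q] m by auto
  define loss where "loss t = real ?m * quad_form (W t) (x t)" for t
  \<comment> \<open>The cap 1/(n-k) compensates the factor n-k, so no round costs more than 1. This
    is the price of a round that is not covered by the entropy argument.\<close>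
  have loss_le: "loss t \<le> 1" if "1 \<le> t" "t \<le> T" for t
  proof -
    have "loss t \<le> real ?m * ((x t \<bullet> x t) / real ?m)"
      unfolding loss_def using capped_quad_form(2)[OF _ x(1)[OF that], of "W t" ?m] Wt[OF that]
      by (intro mult_left_mono) auto
    also have "\<dots> \<le> 1" using x(2)[OF that] m by simp
    finally show ?thesis .
  qed
  \<comment> \<open>For a \<ge> 2 the iterate W a was projected from a matrix that had already been
    mixed, so its entropy bound does not depend on where the interval starts.\<close>
  have late: "(\<Sum>t=a..s. loss t) \<le> (1 + ?\<eta>) * ((\<Sum>t=a..s. real ?m * quad_form Q (x t)) + ?D / ?\<eta>)"
    if Q: "Q \<in> capped n ?m" and a: "2 \<le> a" "a \<le> s" for Q a
  proof -
    have "rel_ent n Q (W a) \<le> rel_ent n Q (?hat (a - 1))"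
      using next_le[of "a - 1" Q] Q a rs by simp
    also have "\<dots> \<le> ln (real n / ?\<alpha>)"
      using hat_update_bounds(3)[OF _ x \<eta> n m(1) \<alpha> Q, of "W (a - 1)" "a - 1"] Wt[of "a - 1"] a rs by auto
    also have "real n / ?\<alpha> = real n * (1 + real ?m * real T)"
      by (simp add: alpha_par_def algebra_simps)
    finally have start: "real ?m * rel_ent n Q (W a) \<le> ?D - 1"
      by (simp add: D_par_def mult_left_mono)
    have "real T * real ?m * (- ln (1 - ?\<alpha>)) \<le> 1"
      unfolding alpha_par_def by (rule mult_neg_ln_le_one[OF mT])
    moreover have "real (s - a + 1) * real ?m * (- ln (1 - ?\<alpha>)) \<le> real T * real ?m * (- ln (1 - ?\<alpha>))"
      using \<alpha> rs a by (intro mult_right_mono) auto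
    ultimately have mix_cost: "real ?m * (- (real (s - a + 1) * ln (1 - ?\<alpha>))) \<le> 1"
      by (simp add: mult_ac)
    have "?\<eta> / (1 + ?\<eta>) * (\<Sum>t=a..s. quad_form (W t) (x t))
      \<le> rel_ent n Q (W a) + ?\<eta> * (\<Sum>t=a..s. quad_form Q (x t)) - real (s - a + 1) * ln (1 - ?\<alpha>)"
      by (rule adaptive_step_sum[OF n m(1) \<alpha> \<eta> a(2) _ _ _ Q]) (use x Wt next_le Q a rs in auto)
    then have "real ?m * (?\<eta> / (1 + ?\<eta>) * (\<Sum>t=a..s. quad_form (W t) (x t)))
      \<le> real ?m * (rel_ent n Q (W a) + ?\<eta> * (\<Sum>t=a..s. quad_form Q (x t)) - real (s - a + 1) * ln (1 - ?\<alpha>))"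
      by (intro mult_left_mono) auto
    also have "\<dots> \<le> ?\<eta> * (\<Sum>t=a..s. real ?m * quad_form Q (x t)) + ?D"
      using start mix_cost by (simp add: algebra_simps flip: sum_distrib_left)
    finally have "?\<eta> / (1 + ?\<eta>) * (\<Sum>t=a..s. loss t) \<le> ?\<eta> * (\<Sum>t=a..s. real ?m * quad_form Q (x t)) + ?D"
      by (simp add: loss_def algebra_simps flip: sum_distrib_left)
    then show ?thesis by (rule rescale_rate[OF \<eta>])
  qed
  \<comment> \<open>No bound on the spectrum of the initial matrix is available, so the first round is
    paid for separately.\<close>
  have total: "(\<Sum>t=r..s. loss t) \<le> 1 + (1 + ?\<eta>) * ((\<Sum>t=r..s. real ?m * quad_form Q (x t)) + ?D / ?\<eta>)"
    if Q: "Q \<in> capped n ?m" for Q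
  proof -
    have q0: "0 \<le> real ?m * quad_form Q (x t)" if "1 \<le> t" "t \<le> T" for t
      using capped_quad_form(1)[OF Q x(1)[OF that]] by simp
    have D\<eta>: "0 \<le> ?D / ?\<eta>" using D \<eta> by simp
    show ?thesis
    proof (cases "r = 1")
      case False
      then show ?thesis using late[OF Q, of r] rs by simp
    next
      case True
      have split: "(\<Sum>t=r..s. f t) = f 1 + (\<Sum>t=2..s. f t)" for f :: "nat \<Rightarrow> real"
        using sum.atLeast_Suc_atMost[of r s f] rs True by (simp add: numeral_2_eq_2)
      have "(\<Sum>t=2..s. loss t) \<le> (1 + ?\<eta>) * ((\<Sum>t=2..s. real ?m * quad_form Q (x t)) + ?D / ?\<eta>)"
      \<comment> \<open>For s = 1 nothing is left after round 1, and the right side only has to be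
        nonnegative.\<close>
      proof (cases "2 \<le> s")
        case True
        then show ?thesis using late[OF Q, of 2] by simp
      next
        case False
        then show ?thesis using D\<eta> \<eta> mult_nonneg_nonneg[of "1 + ?\<eta>" "?D / ?\<eta>"] by simp
      qed
      \<comment> \<open>Restoring the nonnegative comparator loss of round 1 only enlarges the
        bound.\<close>
      also have "\<dots> \<le> (1 + ?\<eta>) * ((\<Sum>t=r..s. real ?m * quad_form Q (x t)) + ?D / ?\<eta>)"
        using q0[of 1] T \<eta> by (intro mult_left_mono) (auto simp: split)
      finally show ?thesis
        using loss_le[of 1] T unfolding split[of loss] by (intro add_mono) auto
    qed
  qed
  \<comment> \<open>The best loss over the capped set. Working with the infimum makes it unnecessary
    to exhibit a best matrix.\<close>
  let ?A = "INF Q\<in>capped n ?m. \<Sum>t=r..s. real ?m * mtrace (Q * outer (x t))"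
  have capped_val: "(\<Sum>t=r..s. real ?m * mtrace (Q * outer (x t))) = (\<Sum>t=r..s. real ?m * quad_form Q (x t))"
    if "Q \<in> capped n ?m" for Q
    using tr cappedD(1)[OF that] rs by (intro sum.cong) auto
  have capped_bdd: "bdd_below ((\<lambda>Q. \<Sum>t=r..s. real ?m * mtrace (Q * outer (x t))) ` capped n ?m)"
    using capped_quad_form(1) x(1) rs
    by (intro bdd_belowI2[of _ 0]) (auto simp: capped_val intro!: sum_nonneg)
  \<comment> \<open>\<open>total\<close> solved for the comparator loss. The left side is free of Q,
    so it bounds the infimum from below.\<close>
  have "((\<Sum>t=r..s. loss t) - 1) / (1 + ?\<eta>) - ?D / ?\<eta> \<le> ?A"
  proof (rule cINF_greatest)
    show "capped n ?m \<noteq> {}" using W1 by blast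
    show "((\<Sum>t=r..s. loss t) - 1) / (1 + ?\<eta>) - ?D / ?\<eta> \<le> (\<Sum>t=r..s. real ?m * mtrace (Q * outer (x t)))"
      if "Q \<in> capped n ?m" for Q
      using total[OF that] \<eta> unfolding capped_val[OF that] diff_le_eq
      by (subst pos_divide_le_eq) (auto simp: mult.commute)
  qed
  then have "((\<Sum>t=r..s. loss t) - 1) / (1 + ?\<eta>) \<le> ?A + ?D / ?\<eta>" by simp
  then have "(\<Sum>t=r..s. loss t) - 1 \<le> (?A + ?D / ?\<eta>) * (1 + ?\<eta>)"
    using \<eta> by (subst (asm) pos_divide_le_eq) auto
  then have "(\<Sum>t=r..s. loss t) - ?A \<le> 1 + ?\<eta> * ?A + (1 + ?\<eta>) * (?D / ?\<eta>)"
    by (simp only: distrib_left distrib_right mult_1_left mult_1_right mult.commute)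
  \<comment> \<open>The assumption on \<open>L\<close> enters here: the comparator loss came with
    the factor 1 + \<eta>, and only its excess \<eta> over 1 remains in the regret.\<close>
  moreover have "?\<eta> * ?A \<le> ?\<eta> * L"
    using \<eta> L_bound rs by (intro mult_left_mono) auto
  moreover have "1 + ?\<eta> * L + (1 + ?\<eta>) * (?D / ?\<eta>) \<le> 3 * (sqrt (2 * L * ?D) + ?D)"
    by (rule tuned_rate_bound[OF D L]) (simp add: eta_par_def)
  \<comment> \<open>Passing from capped matrices to projections: each projection gives a capped
    matrix with the same loss, so the relaxed benchmark is at most the one in the regret.\<close>
  moreover have "?A \<le> (INF U\<in>proj_set n k. \<Sum>t=r..s. mtrace ((1\<^sub>m n - U) * outer (x t)))"
  proof (rule cINF_greatest)
    show "proj_set n k \<noteq> {}" using proj_set_nonempty[of k n] k by simp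
    fix U assume U: "U \<in> proj_set n k"
    let ?Q = "(1 / real ?m) \<cdot>\<^sub>m (1\<^sub>m n - U)"
    have Uc: "1\<^sub>m n - U \<in> carrier_mat n n"
      using U by (auto simp: proj_set_def minus_carrier_mat)
    have "?A \<le> (\<Sum>t=r..s. real ?m * mtrace (?Q * outer (x t)))"
      by (rule cINF_lower[OF capped_bdd proj_complement_in_capped[OF U k(2)]])
    also have "\<dots> = (\<Sum>t=r..s. mtrace ((1\<^sub>m n - U) * outer (x t)))"
    proof (intro sum.cong refl)
      fix t assume t: "t \<in> {r..s}"
      have "outer (x t) \<in> carrier_mat n n" using x(1)[of t] t rs by (simp add: outer_def)
      then show "real ?m * mtrace (?Q * outer (x t)) = mtrace ((1\<^sub>m n - U) * outer (x t))"
        using Uc m by (simp add: mtrace_mult[of _ n] sum_distrib_left del: index_minus_mat)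
    qed
    finally show "?A \<le> (\<Sum>t=r..s. mtrace ((1\<^sub>m n - U) * outer (x t)))" .
  qed
  moreover have "(\<Sum>t=r..s. exp_loss n k (Db t) (mix t) (x t)) = (\<Sum>t=r..s. loss t)"
  proof (intro sum.cong refl)
    fix t assume "t \<in> {r..s}"
    then have t: "1 \<le> t" "t \<le> T" using rs by auto
    have "valid_decomp n k (W t) (Db t) (w t) (mix t)" using decomp t by blast
    then show "exp_loss n k (Db t) (mix t) (x t) = loss t"
      unfolding loss_def by (rule exp_loss_eq[OF _ x(1)[OF t]])
  qed
  ultimately show "(\<Sum>t=r..s. exp_loss n k (Db t) (mix t) (x t))
        - (INF U\<in>proj_set n k. \<Sum>t=r..s. mtrace ((1\<^sub>m n - U) * outer (x t)))
        \<le> 3 * (sqrt (2 * L * ?D) + ?D)"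
    by linarith
qed

end
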